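(* Let $X$ be an infinite-dimensional real Banach space, $p\in\{1,2,\dots\}\cup\{\infty\}$, and let $A\subseteq X$ be a $C^p$ smooth bounded starlike body (starlike with respect to the origin). Then there exists a $C^p$ smooth bump function $g:X\to\mathbb{R}$ such that $\operatorname{supp} g=A$ and $g'(x)\neq0$ for every $x\in\operatorname{int}A$.
   Context: A closed set $A\subseteq X$ is a starlike body (with respect to $0$) if $0\in\operatorname{int}A$ and every ray emanating from $0$ meets the boundary $\partial A$ at most once. Its Minkowski functional is $q_A(x)=\inf\{\lambda>0: x/\lambda\in A\}$, and its characteristic cone is $\{x: rx\in A \text{ for all } r>0\}=q_A^{-1}(0)$. $A$ is $C^p$ smooth if $q_A$ is $C^p$ smooth (Fréchet sense) on $X\setminus q_A^{-1}(0)$; for bounded $A$ this means $q_A$ is $C^p$ on $X\setminus\{0\}$. A bump function is a function not identically zero with bounded support, where $\operatorname{supp} g=\overline{\{x: g(x)\neq0\}}$. *)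

theory Defs
  imports "HOL-Analysis.Analysis" "HOL-Library.Extended_Nat"
begin

definition minkowski_fun :: "'a::real_normed_vector set \<Rightarrow> 'a \<Rightarrow> real" where
  "minkowski_fun A x = Inf {t. t > 0 \<and> scaleR (inverse t) x \<in> A}"

definition starlike_body :: "'a::real_normed_vector set \<Rightarrow> bool" where
  "starlike_body A \<longleftrightarrow> closed A \<and> 0 \<in> interior A \<and>
     (\<forall>x. x \<noteq> 0 \<longrightarrow> (\<forall>s t. s \<ge> 0 \<longrightarrow> t \<ge> 0 \<longrightarrow>
        scaleR s x \<in> frontier A \<longrightarrow> scaleR t x \<in> frontier A \<longrightarrow> s = t))"

text \<open>Higher Frechet derivatives are represented as j-linear maps
  L :: (nat \<Rightarrow> 'a) \<Rightarrow> 'b depending only on the arguments v 0, ..., v (j-1).\<close>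
definition multilinear_bdd :: "nat \<Rightarrow> ((nat \<Rightarrow> 'a::real_normed_vector) \<Rightarrow> 'b::real_normed_vector) \<Rightarrow> bool" where
  "multilinear_bdd j L \<longleftrightarrow>
     (\<forall>v w. (\<forall>i<j. v i = w i) \<longrightarrow> L v = L w) \<and>
     (\<forall>i<j. \<forall>v. linear (\<lambda>t. L (v(i := t)))) \<and>
     (\<exists>C. \<forall>v. norm (L v) \<le> C * (\<Prod>i<j. norm (v i)))"

definition mnorm :: "nat \<Rightarrow> ((nat \<Rightarrow> 'a::real_normed_vector) \<Rightarrow> 'b::real_normed_vector) \<Rightarrow> real" where
  "mnorm j L = (SUP v \<in> {v. \<forall>i<j. norm (v i) \<le> 1}. norm (L v))"

definition Ck_on :: "nat \<Rightarrow> ('a::real_normed_vector \<Rightarrow> 'b::real_normed_vector) \<Rightarrow> 'a set \<Rightarrow> bool" where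
  "Ck_on k f U \<longleftrightarrow> (\<exists>D :: nat \<Rightarrow> 'a \<Rightarrow> (nat \<Rightarrow> 'a) \<Rightarrow> 'b.
     (\<forall>x\<in>U. \<forall>v. D 0 x v = f x) \<and>
     (\<forall>j\<le>k. \<forall>x\<in>U. multilinear_bdd j (D j x)) \<and>
     (\<forall>j<k. \<forall>x\<in>U.
        ((\<lambda>h. mnorm j (\<lambda>v. D j (x + h) v - D j x v - D (Suc j) x (v(j := h))) / norm h)
           \<longlongrightarrow> 0) (at 0)) \<and>
     (\<forall>x\<in>U. ((\<lambda>y. mnorm k (\<lambda>v. D k y v - D k x v)) \<longlongrightarrow> 0) (at x)))"

definition Cp_on :: "enat \<Rightarrow> ('a::real_normed_vector \<Rightarrow> 'b::real_normed_vector) \<Rightarrow> 'a set \<Rightarrow> bool" where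
  "Cp_on p f U \<longleftrightarrow> (\<forall>k. enat k \<le> p \<longrightarrow> Ck_on k f U)"

definition smooth_body :: "enat \<Rightarrow> 'a::real_normed_vector set \<Rightarrow> bool" where
  "smooth_body p A \<longleftrightarrow> Cp_on p (minkowski_fun A) (UNIV - {x. minkowski_fun A x = 0})"

definition supp :: "('a::real_normed_vector \<Rightarrow> real) \<Rightarrow> 'a set" where
  "supp g = closure {x. g x \<noteq> 0}"

definition bump :: "('a::real_normed_vector \<Rightarrow> real) \<Rightarrow> bool" where
  "bump g \<longleftrightarrow> (\<exists>x. g x \<noteq> 0) \<and> bounded (supp g)"

end

(* Let q be the Minkowski functional of A. The function lam(q), with lam equal to 1 near 0 and
   strictly decreasing to a flat zero at 1, has its critical points in int A inside a small ball
   {q <= r}. In an infinite-dimensional space this ball can be pushed to infinity within A: choose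
   a bounded sequence P 0 = 0, P 1, P 2, ... such that thin tubes around the lines through
   P n and P (n + 1) form a locally finite family, and let
   k n x = x - phi n x * (P (n + 1) - P n) translate the ball around P (n + 1) to the ball around
   P n, with phi n supported in the n-th tube and of slope less than 1 in the direction of the tube.
   Then each k n is an injective smooth map with invertible derivatives, so that the critical points
   of lam(q) o k 0 o ... o k n lie in the ball around P (n + 1), and by local finiteness
   these functions converge, locally after finitely many steps, to a function without critical
   points in int A.

   Higher derivatives are handled through sets of real-valued functions that are C^k with uniform
   estimates: differentiating such a set in all directions of norm at most 1 yields a set of
   functions of the same type, which permits induction on k. *)
theory Submission
  imports Defs
begin

section \<open>Equi-smooth families of real functions\<close>

text \<open>A general Banach space offers no smooth norm, so q itself has to serve as the radial
  function: it measures the critical ball and, after a projection along the axis, the cross-section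
  of every tube. As q need not be differentiable at 0, it enters only through cutoffs that are
  constant near 0. Infinite dimension supplies unit vectors u n and norming functionals f n with f i
  (u n) = 0 for i < n. For P n = \<tau> (u n - u 0) the functionals f n and f (Suc n) separate the
  n-th tube from all tubes of index n + 2 and above, at a distance that does not depend on n; local
  finiteness rests on this. Consecutive tubes cannot be separated, as both contain P (Suc n). The
  maps k n are never inverted. Tracing critical points through the chain rule takes surjectivity of
  the derivative of k n, and locating the preimage of the critical ball takes injectivity along
  lines parallel to the tube; both follow from the slope being less than 1. The tubes and their
  images lie in a ball inside int A, so the values of lam(q) outside int A are never
  altered.\<close>

definition equibounded_at :: "'i set \<Rightarrow> ('i \<Rightarrow> 'a \<Rightarrow> real) \<Rightarrow> 'a \<Rightarrow> bool" where
  "equibounded_at I F x \<longleftrightarrow> (\<exists>B. \<forall>i\<in>I. \<bar>F i x\<bar> \<le> B)"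

definition equicont_at :: "'i set \<Rightarrow> ('i \<Rightarrow> 'a::real_normed_vector \<Rightarrow> real) \<Rightarrow> 'a \<Rightarrow> bool" where
  "equicont_at I F x \<longleftrightarrow> (\<forall>e>0. \<forall>\<^sub>F y in nhds x. \<forall>i\<in>I. \<bar>F i y - F i x\<bar> \<le> e)"

text \<open>Families are indexed so that products can be indexed by pairs and derivatives by tuples
  of directions. The error e * norm (y - x) is not written as a quotient, so y = x is harmless. The
  common bound on the D i yields equicontinuity.\<close>

definition equidiff_at ::
  "'i set \<Rightarrow> ('i \<Rightarrow> 'a::real_normed_vector \<Rightarrow> real) \<Rightarrow> ('i \<Rightarrow> 'a \<Rightarrow> real) \<Rightarrow> 'a \<Rightarrow> bool" where
  "equidiff_at I F D x \<longleftrightarrow> (\<forall>i\<in>I. linear (D i)) \<and> (\<exists>B. \<forall>i\<in>I. \<forall>h. \<bar>D i h\<bar> \<le> B * norm h) \<and>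
     (\<forall>e>0. \<forall>\<^sub>F y in nhds x. \<forall>i\<in>I. \<bar>F i y - F i x - D i (y - x)\<bar> \<le> e * norm (y - x))"

text \<open>Uniformity over directions of norm at most 1 encodes the operator norm: the functions x
  |-> f'(x) v are equidifferentiable over these v when f' is Frechet differentiable. For a single
  function this matches \<open>Ck_on\<close>, by \<open>Ck_on_imp_equi_Ck\<close> on open sets and
  by \<open>equi_Ck_imp_Ck_on\<close> on the whole space. Bounds are uniform over the functions, not
  over the points.\<close>

primrec equi_Ck :: "nat \<Rightarrow> ('a::real_normed_vector \<Rightarrow> real) set \<Rightarrow> 'a set \<Rightarrow> bool" where
  "equi_Ck 0 S U \<longleftrightarrow> (\<forall>x\<in>U. equibounded_at S (\<lambda>f. f) x \<and> equicont_at S (\<lambda>f. f) x)"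
| "equi_Ck (Suc k) S U \<longleftrightarrow>
     (\<forall>x\<in>U. equibounded_at S (\<lambda>f. f) x \<and>
        equidiff_at S (\<lambda>f. f) (\<lambda>f. frechet_derivative f (at x)) x) \<and>
     equi_Ck k {\<lambda>x. frechet_derivative f (at x) v |f v. f \<in> S \<and> norm v \<le> 1} U"

lemma equidiff_at_has_derivative:
  assumes "equidiff_at I F D x" "i \<in> I"
  shows "(F i has_derivative D i) (at x)"
  unfolding has_derivative_at_alt
proof (intro conjI allI impI)
  obtain B where B: "\<forall>i\<in>I. \<forall>h. \<bar>D i h\<bar> \<le> B * norm h"
    using assms unfolding equidiff_at_def by blast
  show "bounded_linear (D i)"
    using assms B unfolding equidiff_at_def bounded_linear_def bounded_linear_axioms_def
    by (metis mult.commute real_norm_def)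
next
  fix e :: real assume "e > 0"
  then have "\<forall>\<^sub>F y in nhds x. \<forall>i\<in>I. \<bar>F i y - F i x - D i (y - x)\<bar> \<le> e * norm (y - x)"
    using assms unfolding equidiff_at_def by blast
  then show "\<exists>d>0. \<forall>y. norm (y - x) < d \<longrightarrow> norm (F i y - F i x - D i (y - x)) \<le> e * norm (y - x)"
    unfolding eventually_nhds_metric dist_norm using assms(2) by auto
qed

text \<open>The map \<open>s\<close> matches each function with one that agrees with it near x. This
  serves both for families compared up to equality on U and for replacing an index set by its
  image.\<close>

lemma equidiff_at_cong:
  assumes "equidiff_at J G E x" and U: "open U" "x \<in> U"
    and "\<And>i. i \<in> I \<Longrightarrow> s i \<in> J" "\<And>i. i \<in> I \<Longrightarrow> D i = E (s i)"
    and eq: "\<And>i y. i \<in> I \<Longrightarrow> y \<in> U \<Longrightarrow> F i y = G (s i) y"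
  shows "equidiff_at I F D x"
  unfolding equidiff_at_def
proof (intro conjI allI impI)
  show "\<forall>i\<in>I. linear (D i)" "\<exists>B. \<forall>i\<in>I. \<forall>h. \<bar>D i h\<bar> \<le> B * norm h"
    using assms unfolding equidiff_at_def by metis+
  fix e :: real assume "e > 0"
  then have "\<forall>\<^sub>F y in nhds x. \<forall>i\<in>J. \<bar>G i y - G i x - E i (y - x)\<bar> \<le> e * norm (y - x)"
    using assms unfolding equidiff_at_def by blast
  moreover have "\<forall>\<^sub>F y in nhds x. y \<in> U"
    using U by (rule eventually_nhds_in_open)
  ultimately show "\<forall>\<^sub>F y in nhds x. \<forall>i\<in>I. \<bar>F i y - F i x - D i (y - x)\<bar> \<le> e * norm (y - x)"
    by eventually_elim (use assms in auto)
qed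

lemma equi_Ck_equibounded: "equi_Ck k S U \<Longrightarrow> x \<in> U \<Longrightarrow> equibounded_at S (\<lambda>f. f) x"
  by (cases k) auto

text \<open>The functions are total, but only their values on U matter, since on an open set
  agreement carries over to Frechet derivatives. Derivatives computed by a rule lie in the sets of
  sums and products built below only up to equality on U.\<close>

lemma equi_Ck_mono:
  assumes "open U" "equi_Ck k T U" "\<And>f. f \<in> S \<Longrightarrow> \<exists>g\<in>T. \<forall>x\<in>U. f x = g x"
  shows "equi_Ck k S U"
  using assms(2,3)
proof (induction k arbitrary: S T)
  case 0
  obtain s where s: "\<And>f. f \<in> S \<Longrightarrow> s f \<in> T" "\<And>f x. f \<in> S \<Longrightarrow> x \<in> U \<Longrightarrow> f x = s f x"
    using 0(2) by metis
  show ?case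
    unfolding equi_Ck.simps
  proof (intro ballI conjI)
    fix x assume x: "x \<in> U"
    show "equibounded_at S (\<lambda>f. f) x"
      using 0(1) s x unfolding equibounded_at_def equi_Ck.simps by metis
    show "equicont_at S (\<lambda>f. f) x"
      unfolding equicont_at_def
    proof (intro allI impI)
      fix e :: real assume "e > 0"
      then have "\<forall>\<^sub>F y in nhds x. \<forall>i\<in>T. \<bar>i y - i x\<bar> \<le> e"
        using 0(1) x unfolding equicont_at_def equi_Ck.simps by blast
      moreover have "\<forall>\<^sub>F y in nhds x. y \<in> U"
        using assms(1) x by (rule eventually_nhds_in_open)
      ultimately show "\<forall>\<^sub>F y in nhds x. \<forall>i\<in>S. \<bar>i y - i x\<bar> \<le> e"
      proof eventually_elim
        case (elim y)
        show ?case
        proof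
          fix f assume f: "f \<in> S"
          show "\<bar>f y - f x\<bar> \<le> e"
            using elim s(1)[OF f] s(2)[OF f x] s(2)[OF f, of y] by simp
        qed
      qed
    qed
  qed
next
  case (Suc k)
  obtain s where s: "\<And>f. f \<in> S \<Longrightarrow> s f \<in> T" "\<And>f x. f \<in> S \<Longrightarrow> x \<in> U \<Longrightarrow> f x = s f x"
    using Suc(3) by metis
  have T: "equidiff_at T (\<lambda>f. f) (\<lambda>f. frechet_derivative f (at x)) x" if "x \<in> U" for x
    using Suc(2) that by simp
  have fd: "frechet_derivative f (at x) = frechet_derivative (s f) (at x)" if "f \<in> S" "x \<in> U" for f x
  proof -
    have "(s f has_derivative frechet_derivative (s f) (at x)) (at x)"
      using equidiff_at_has_derivative[OF T[OF that(2)] s(1)[OF that(1)]] .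
    then have "(f has_derivative frechet_derivative (s f) (at x)) (at x)"
      by (rule has_derivative_transform_within_open[OF _ assms(1) that(2)]) (use s that in auto)
    then show ?thesis
      using frechet_derivative_at by metis
  qed
  show ?case
    unfolding equi_Ck.simps
  proof (intro ballI conjI)
    fix x assume x: "x \<in> U"
    show "equibounded_at S (\<lambda>f. f) x"
      using equi_Ck_equibounded[OF Suc(2) x] s x unfolding equibounded_at_def by metis
    show "equidiff_at S (\<lambda>f. f) (\<lambda>f. frechet_derivative f (at x)) x"
      by (rule equidiff_at_cong[OF T[OF x] assms(1) x, of _ s]) (use s fd x in auto)
  next
    show "equi_Ck k {\<lambda>x. frechet_derivative f (at x) v |f v. f \<in> S \<and> norm v \<le> 1} U"
    proof (rule Suc(1))
      show "equi_Ck k {\<lambda>x. frechet_derivative f (at x) v |f v. f \<in> T \<and> norm v \<le> 1} U"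
        using Suc(2) by simp
      fix f assume "f \<in> {\<lambda>x. frechet_derivative f (at x) v |f v. f \<in> S \<and> norm v \<le> 1}"
      then show "\<exists>g\<in>{\<lambda>x. frechet_derivative f (at x) v |f v. f \<in> T \<and> norm v \<le> 1}. \<forall>x\<in>U. f x = g x"
        using s fd by fastforce
    qed
  qed
qed

lemma equi_Ck_subset: "open U \<Longrightarrow> equi_Ck k T U \<Longrightarrow> S \<subseteq> T \<Longrightarrow> equi_Ck k S U"
  by (rule equi_Ck_mono) auto

text \<open>For derivatives given by a formula: in place of the set of chosen Frechet derivatives it
  is enough to name a set \<open>T\<close> of order k that contains the directional derivatives up
  to equality on U.\<close>

lemma equi_Ck_SucI:
  fixes D :: "'i \<Rightarrow> 'a::real_normed_vector \<Rightarrow> 'a \<Rightarrow> real"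
  assumes U: "open U" and b: "\<And>x. x \<in> U \<Longrightarrow> equibounded_at I F x"
    and d: "\<And>x. x \<in> U \<Longrightarrow> equidiff_at I F (\<lambda>i. D i x) x"
    and T: "equi_Ck k T U"
    and D: "\<And>i v. i \<in> I \<Longrightarrow> norm v \<le> 1 \<Longrightarrow> \<exists>g\<in>T. \<forall>x\<in>U. D i x v = g x"
  shows "equi_Ck (Suc k) (F ` I) U"
proof -
  have fd: "frechet_derivative (F i) (at x) = D i x" if "i \<in> I" "x \<in> U" for i x
    using equidiff_at_has_derivative[OF d[OF that(2)] that(1)] frechet_derivative_at by metis
  obtain s where s: "\<And>f. f \<in> F ` I \<Longrightarrow> s f \<in> I \<and> f = F (s f)"
    by (metis f_inv_into_f inv_into_into)
  show ?thesis
    unfolding equi_Ck.simps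
  proof (intro ballI conjI)
    fix x assume x: "x \<in> U"
    show "equibounded_at (F ` I) (\<lambda>f. f) x"
      using b[OF x] unfolding equibounded_at_def by auto
    show "equidiff_at (F ` I) (\<lambda>f. f) (\<lambda>f. frechet_derivative f (at x)) x"
    proof (rule equidiff_at_cong[OF d[OF x] U x, of _ s])
      fix f assume f: "f \<in> F ` I"
      show "s f \<in> I" "\<And>y. f y = F (s f) y" using s[OF f] by auto
      show "frechet_derivative f (at x) = D (s f) x"
        using s[OF f] fd[of "s f" x] x by metis
    qed
  next
    show "equi_Ck k {\<lambda>x. frechet_derivative f (at x) v |f v. f \<in> F ` I \<and> norm v \<le> 1} U"
      by (rule equi_Ck_mono[OF U T]) (use D fd in fastforce)
  qed
qed

lemma equidiff_at_equicont:
  assumes "equidiff_at I F D x"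
  shows "equicont_at I F x"
  unfolding equicont_at_def
proof (intro allI impI)
  fix e :: real assume e: "e > 0"
  obtain B where B: "\<forall>i\<in>I. \<forall>h. \<bar>D i h\<bar> \<le> B * norm h"
    using assms unfolding equidiff_at_def by blast
  have 1: "\<forall>\<^sub>F y in nhds x. \<forall>i\<in>I. \<bar>F i y - F i x - D i (y - x)\<bar> \<le> 1 * norm (y - x)"
    using assms unfolding equidiff_at_def using zero_less_one by blast
  define d where "d = e / (\<bar>B\<bar> + 1)"
  have d: "d > 0" unfolding d_def using e by simp
  have 2: "\<forall>\<^sub>F y in nhds x. dist y x < d"
    using d unfolding eventually_nhds_metric by blast
  show "\<forall>\<^sub>F y in nhds x. \<forall>i\<in>I. \<bar>F i y - F i x\<bar> \<le> e"
    using 1 2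
  proof eventually_elim
    case (elim y)
    show ?case
    proof
      fix i assume i: "i \<in> I"
      have "\<bar>F i y - F i x\<bar> \<le> 1 * norm (y - x) + B * norm (y - x)"
        using elim i B by (smt (verit))
      also have "\<dots> \<le> (\<bar>B\<bar> + 1) * norm (y - x)"
        by (simp add: algebra_simps mult_left_mono mult_right_mono)
      also have "\<dots> \<le> (\<bar>B\<bar> + 1) * d"
        using elim by (intro mult_left_mono) (auto simp: dist_norm)
      finally show "\<bar>F i y - F i x\<bar> \<le> e"
        unfolding d_def by simp
    qed
  qed
qed

lemma equi_Ck_equicont: "equi_Ck k S U \<Longrightarrow> x \<in> U \<Longrightarrow> equicont_at S (\<lambda>f. f) x"
  by (cases k) (auto intro: equidiff_at_equicont)

lemma equi_Ck_Suc: "equi_Ck (Suc k) S U \<Longrightarrow> equi_Ck k S U"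
proof (induction k arbitrary: S)
  case 0
  then show ?case by (auto intro: equidiff_at_equicont)
next
  case (Suc k)
  show ?case
    using Suc(2) Suc(1)[of "{\<lambda>x. frechet_derivative f (at x) v |f v. f \<in> S \<and> norm v \<le> 1}"]
    unfolding equi_Ck.simps(2)[of "Suc k" S] equi_Ck.simps(2)[of k S] by blast
qed

text \<open>Every clause is pointwise in x, so smoothness is local.\<close>

lemma equi_Ck_Union:
  assumes "\<And>U. U \<in> C \<Longrightarrow> equi_Ck k S U"
  shows "equi_Ck k S (\<Union>C)"
  using assms
proof (induction k arbitrary: S)
  case (Suc k)
  have "equi_Ck k {\<lambda>x. frechet_derivative f (at x) v |f v. f \<in> S \<and> norm v \<le> 1} (\<Union>C)"
    by (rule Suc(1)) (use Suc(2) in simp)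
  then show ?case using Suc(2) by auto
qed auto

text \<open>Supplies scalar factors. The derivatives form the instance M = 0 of the same family,
  hence the induction over all M.\<close>

lemma equi_Ck_const: "open U \<Longrightarrow> equi_Ck k ((\<lambda>c x. c) ` {c. \<bar>c\<bar> \<le> M}) U"
proof (induction k arbitrary: M)
  case 0
  then show ?case by (auto simp: equibounded_at_def equicont_at_def)
next
  case (Suc k)
  show ?case
  proof (rule equi_Ck_SucI[OF Suc(2), where D = "\<lambda>_ _ _. 0"])
    show "equi_Ck k ((\<lambda>c x. c) ` {c. \<bar>c\<bar> \<le> 0}) U" using Suc by blast
    show "equibounded_at {c. \<bar>c\<bar> \<le> M} (\<lambda>c x. c) x" for x :: 'a
      unfolding equibounded_at_def by auto
    show "equidiff_at {c. \<bar>c\<bar> \<le> M} (\<lambda>c x. c) (\<lambda>i h. 0) x" for x :: 'a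
      unfolding equidiff_at_def by (auto intro!: linear_zero exI[of _ 0])
  qed auto
qed

section \<open>Sums, products and composites of equi-smooth families\<close>

lemma equicont_at_bounded:
  assumes "equibounded_at I F x" "equicont_at I F x"
  obtains B where "B > 0" "\<forall>\<^sub>F y in nhds x. \<forall>i\<in>I. \<bar>F i y\<bar> \<le> B"
proof -
  obtain B where B: "\<forall>i\<in>I. \<bar>F i x\<bar> \<le> B"
    using assms unfolding equibounded_at_def by blast
  have "\<forall>\<^sub>F y in nhds x. \<forall>i\<in>I. \<bar>F i y - F i x\<bar> \<le> 1"
    using assms unfolding equicont_at_def using zero_less_one by blast
  then have "\<forall>\<^sub>F y in nhds x. \<forall>i\<in>I. \<bar>F i y\<bar> \<le> \<bar>B\<bar> + 1"
    by eventually_elim (use B in fastforce)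
  then show ?thesis
    by (intro that[of "\<bar>B\<bar> + 1"]) auto
qed

lemma equicont_at_add:
  assumes F: "equicont_at I F x" and G: "equicont_at J G x"
  shows "equicont_at (I \<times> J) (\<lambda>(i,j) x. F i x + G j x) x"
  unfolding equicont_at_def
proof (intro allI impI)
  fix e :: real assume e: "e > 0"
  have "\<forall>\<^sub>F y in nhds x. \<forall>i\<in>I. \<bar>F i y - F i x\<bar> \<le> e / 2"
    "\<forall>\<^sub>F y in nhds x. \<forall>i\<in>J. \<bar>G i y - G i x\<bar> \<le> e / 2"
    using F G e unfolding equicont_at_def by (meson half_gt_zero)+
  then show "\<forall>\<^sub>F y in nhds x. \<forall>i\<in>I \<times> J.
      \<bar>(case i of (i, j) \<Rightarrow> \<lambda>x. F i x + G j x) y - (case i of (i, j) \<Rightarrow> \<lambda>x. F i x + G j x) x\<bar> \<le> e"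
  proof eventually_elim
    case (elim y)
    have "\<bar>F i y + G j y - (F i x + G j x)\<bar> \<le> e" if "i \<in> I" "j \<in> J" for i j
      using elim(1)[rule_format, OF that(1)] elim(2)[rule_format, OF that(2)] by linarith
    then show ?case by auto
  qed
qed

lemma equidiff_at_add:
  assumes F: "equidiff_at I F D x" and G: "equidiff_at J G E x"
  shows "equidiff_at (I \<times> J) (\<lambda>(i,j) x. F i x + G j x) (\<lambda>(i,j) h. D i h + E j h) x"
  unfolding equidiff_at_def
proof (intro conjI allI impI)
  obtain B C where BC: "\<forall>i\<in>I. \<forall>h. \<bar>D i h\<bar> \<le> B * norm h" "\<forall>i\<in>J. \<forall>h. \<bar>E i h\<bar> \<le> C * norm h"
    using F G unfolding equidiff_at_def by blast
  have "\<bar>D i h + E j h\<bar> \<le> (B + C) * norm h" if "i \<in> I" "j \<in> J" for i j h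
    unfolding distrib_right by (rule order_trans[OF abs_triangle_ineq]) (use BC that in \<open>intro add_mono; blast\<close>)
  then show "\<exists>B. \<forall>i\<in>I \<times> J. \<forall>h. \<bar>(case i of (i, j) \<Rightarrow> \<lambda>h. D i h + E j h) h\<bar> \<le> B * norm h"
    by (intro exI[of _ "B + C"]) auto
  show "\<forall>i\<in>I \<times> J. linear (case i of (i, j) \<Rightarrow> \<lambda>h. D i h + E j h)"
    using F G unfolding equidiff_at_def by (auto intro: linear_compose_add)
  fix e :: real assume e: "e > 0"
  have "\<forall>\<^sub>F y in nhds x. \<forall>i\<in>I. \<bar>F i y - F i x - D i (y - x)\<bar> \<le> e / 2 * norm (y - x)"
    "\<forall>\<^sub>F y in nhds x. \<forall>i\<in>J. \<bar>G i y - G i x - E i (y - x)\<bar> \<le> e / 2 * norm (y - x)"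
    using F G e unfolding equidiff_at_def by (meson half_gt_zero)+
  then show "\<forall>\<^sub>F y in nhds x. \<forall>i\<in>I \<times> J.
      \<bar>(case i of (i, j) \<Rightarrow> \<lambda>x. F i x + G j x) y - (case i of (i, j) \<Rightarrow> \<lambda>x. F i x + G j x) x -
        (case i of (i, j) \<Rightarrow> \<lambda>h. D i h + E j h) (y - x)\<bar> \<le> e * norm (y - x)"
  proof eventually_elim
    case (elim y)
    have "\<bar>F i y + G j y - (F i x + G j x) - (D i (y - x) + E j (y - x))\<bar> \<le> e * norm (y - x)"
      if "i \<in> I" "j \<in> J" for i j
      using elim(1)[rule_format, OF that(1)] elim(2)[rule_format, OF that(2)] by linarith
    then show ?case by auto
  qed
qed

lemma equibounded_at_add:
  assumes "equibounded_at I F x" "equibounded_at J G x"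
  shows "equibounded_at (I \<times> J) (\<lambda>(i,j) x. F i x + G j x) x"
proof -
  obtain B C where BC: "\<forall>i\<in>I. \<bar>F i x\<bar> \<le> B" "\<forall>i\<in>J. \<bar>G i x\<bar> \<le> C"
    using assms unfolding equibounded_at_def by blast
  have "\<bar>F i x + G j x\<bar> \<le> B + C" if "i \<in> I" "j \<in> J" for i j
    by (rule order_trans[OF abs_triangle_ineq]) (use BC that in \<open>intro add_mono; blast\<close>)
  then show ?thesis
    unfolding equibounded_at_def by (intro exI[of _ "B + C"]) auto
qed

lemma equi_Ck_0I:
  assumes "\<And>x. x \<in> U \<Longrightarrow> equibounded_at I F x" "\<And>x. x \<in> U \<Longrightarrow> equicont_at I F x"
  shows "equi_Ck 0 (F ` I) U"
  using assms by (auto simp: equibounded_at_def equicont_at_def)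

lemma equi_Ck_add:
  assumes "open U" "equi_Ck k S U" "equi_Ck k T U"
  shows "equi_Ck k ((\<lambda>(f,g) x. f x + g x) ` (S \<times> T)) U"
  using assms(2,3)
proof (induction k arbitrary: S T)
  case 0
  show ?case
    by (intro equi_Ck_0I equibounded_at_add equicont_at_add) (use 0 in auto)
next
  case (Suc k)
  let ?S = "\<lambda>S. {\<lambda>x. frechet_derivative f (at x) v |f v::'a. f \<in> S \<and> norm v \<le> 1}"
  let ?T = "(\<lambda>(f,g) x. f x + g x) ` (?S S \<times> ?S T)"
  show ?case
  proof (rule equi_Ck_SucI[OF assms(1), where T = ?T and
        D = "\<lambda>(f,g) x h. frechet_derivative f (at x) h + frechet_derivative g (at x) h"])
    fix x assume x: "x \<in> U"
    show "equibounded_at (S \<times> T) (\<lambda>(f, g) x. f x + g x) x"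
      by (intro equibounded_at_add equi_Ck_equibounded[OF Suc(2) x] equi_Ck_equibounded[OF Suc(3) x])
    show "equidiff_at (S \<times> T) (\<lambda>(f, g) x. f x + g x)
        (\<lambda>i. (case i of (f, g) \<Rightarrow> \<lambda>x h. frechet_derivative f (at x) h + frechet_derivative g (at x) h) x) x"
      using equidiff_at_add[of S "\<lambda>f. f" "\<lambda>f. frechet_derivative f (at x)" x T "\<lambda>f. f" "\<lambda>f. frechet_derivative f (at x)"]
        Suc(2,3) x by (simp add: case_prod_unfold)
  next
    show "equi_Ck k ?T U"
      using Suc(2,3) by (intro Suc(1)) auto
  next
    fix i v assume i: "i \<in> S \<times> T" "norm (v::'a) \<le> 1"
    obtain f g where fg: "i = (f, g)" by (cases i)
    have "(\<lambda>(f,g) x. f x + g x) (\<lambda>x. frechet_derivative f (at x) v, \<lambda>x. frechet_derivative g (at x) v) \<in> ?T"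
      by (rule imageI) (use i fg in blast)
    then show "\<exists>g\<in>?T. \<forall>x\<in>U. (case i of (f, g) \<Rightarrow> \<lambda>x h. frechet_derivative f (at x) h + frechet_derivative g (at x) h) x v = g x"
      by (rule bexI[rotated]) (simp add: fg)
  qed
qed

lemma equibounded_at_mult:
  assumes "equibounded_at I F x" "equibounded_at J G x"
  shows "equibounded_at (I \<times> J) (\<lambda>(i,j) x. F i x * G j x) x"
proof -
  obtain B C where BC: "\<forall>i\<in>I. \<bar>F i x\<bar> \<le> B" "\<forall>i\<in>J. \<bar>G i x\<bar> \<le> C"
    using assms unfolding equibounded_at_def by blast
  have "\<bar>F i x * G j x\<bar> \<le> B * C" if "i \<in> I" "j \<in> J" for i j
    unfolding abs_mult by (rule mult_mono') (use BC that in auto)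
  then show ?thesis
    unfolding equibounded_at_def by (intro exI[of _ "B * C"]) auto
qed

lemma equicont_at_mult:
  assumes F: "equibounded_at I F x" "equicont_at I F x" and G: "equibounded_at J G x" "equicont_at J G x"
  shows "equicont_at (I \<times> J) (\<lambda>(i,j) x. F i x * G j x) x"
  unfolding equicont_at_def
proof (intro allI impI)
  fix e :: real assume e: "e > 0"
  obtain B where B: "B > 0" "\<forall>\<^sub>F y in nhds x. \<forall>i\<in>I. \<bar>F i y\<bar> \<le> B"
    using equicont_at_bounded[OF F] .
  obtain C where C: "C > 0" "\<forall>\<^sub>F y in nhds x. \<forall>i\<in>J. \<bar>G i y\<bar> \<le> C"
    using equicont_at_bounded[OF G] .
  have "\<forall>\<^sub>F y in nhds x. \<forall>i\<in>I. \<bar>F i y - F i x\<bar> \<le> e / (2 * C)"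
    "\<forall>\<^sub>F y in nhds x. \<forall>i\<in>J. \<bar>G i y - G i x\<bar> \<le> e / (2 * B)"
    using F(2) G(2) e B(1) C(1) unfolding equicont_at_def by (simp_all add: divide_pos_pos)
  then show "\<forall>\<^sub>F y in nhds x. \<forall>i\<in>I \<times> J.
      \<bar>(case i of (i, j) \<Rightarrow> \<lambda>x. F i x * G j x) y - (case i of (i, j) \<Rightarrow> \<lambda>x. F i x * G j x) x\<bar> \<le> e"
    using B(2) C(2)
  proof eventually_elim
    case (elim y)
    have "\<bar>F i y * G j y - F i x * G j x\<bar> \<le> e" if "i \<in> I" "j \<in> J" for i j
    proof -
      have "F i y * G j y - F i x * G j x = (F i y - F i x) * G j y + F i x * (G j y - G j x)"
        by (simp add: algebra_simps)
      also have "\<bar>\<dots>\<bar> \<le> \<bar>F i y - F i x\<bar> * \<bar>G j y\<bar> + \<bar>F i x\<bar> * \<bar>G j y - G j x\<bar>"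
        unfolding abs_mult[symmetric] by (rule abs_triangle_ineq)
      also have "\<dots> \<le> e / (2 * C) * C + B * (e / (2 * B))"
        using elim that eventually_nhds_x_imp_x[OF B(2)] e B(1) C(1)
        by (intro add_mono mult_mono) auto
      also have "\<dots> = e"
        using B(1) C(1) by simp
      finally show ?thesis .
    qed
    then show ?case by auto
  qed
qed

lemma equidiff_atD:
  "equidiff_at I F D x \<Longrightarrow> e > 0 \<Longrightarrow>
    \<forall>\<^sub>F y in nhds x. \<forall>i\<in>I. \<bar>F i y - F i x - D i (y - x)\<bar> \<le> e * norm (y - x)"
  unfolding equidiff_at_def by blast

lemma equidiff_at_mult:
  assumes F: "equibounded_at I F x" "equidiff_at I F D x"
    and G: "equibounded_at J G x" "equidiff_at J G E x"
  shows "equidiff_at (I \<times> J) (\<lambda>(i,j) x. F i x * G j x) (\<lambda>(i,j) h. D i h * G j x + F i x * E j h) x"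
  unfolding equidiff_at_def
proof (intro conjI allI impI)
  obtain B where B: "B > 0" "\<forall>\<^sub>F y in nhds x. \<forall>i\<in>I. \<bar>F i y\<bar> \<le> B"
    using equicont_at_bounded[OF F(1) equidiff_at_equicont[OF F(2)]] .
  obtain C where C: "C > 0" "\<forall>\<^sub>F y in nhds x. \<forall>i\<in>J. \<bar>G i y\<bar> \<le> C"
    using equicont_at_bounded[OF G(1) equidiff_at_equicont[OF G(2)]] .
  have Bx: "\<forall>i\<in>I. \<bar>F i x\<bar> \<le> B" and Cx: "\<forall>i\<in>J. \<bar>G i x\<bar> \<le> C"
    using eventually_nhds_x_imp_x[OF B(2)] eventually_nhds_x_imp_x[OF C(2)] by auto
  obtain B1 C1 where BC1: "\<forall>i\<in>I. \<forall>h. \<bar>D i h\<bar> \<le> B1 * norm h" "\<forall>i\<in>J. \<forall>h. \<bar>E i h\<bar> \<le> C1 * norm h"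
    using F G unfolding equidiff_at_def by blast
  have "\<bar>D i h * G j x + F i x * E j h\<bar> \<le> (B1 * C + B * C1) * norm h" if "i \<in> I" "j \<in> J" for i j h
  proof -
    have "\<bar>D i h * G j x + F i x * E j h\<bar> \<le> \<bar>D i h\<bar> * \<bar>G j x\<bar> + \<bar>F i x\<bar> * \<bar>E j h\<bar>"
      unfolding abs_mult[symmetric] by (rule abs_triangle_ineq)
    also have "\<dots> \<le> (B1 * norm h) * C + B * (C1 * norm h)"
      using BC1 Bx Cx that by (intro add_mono mult_mono') auto
    finally show ?thesis by (simp add: algebra_simps)
  qed
  then show "\<exists>B. \<forall>i\<in>I \<times> J. \<forall>h. \<bar>(case i of (i, j) \<Rightarrow> \<lambda>h. D i h * G j x + F i x * E j h) h\<bar> \<le> B * norm h"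
    by (intro exI[of _ "B1 * C + B * C1"]) auto
  have "linear (\<lambda>h. D i h * G j x + F i x * E j h)" if "i \<in> I" "j \<in> J" for i j
  proof -
    have "linear (D i)" "linear (E j)" using F G that unfolding equidiff_at_def by auto
    then show ?thesis
      by (auto intro!: linearI simp: linear_add linear_scale algebra_simps)
  qed
  then show "\<forall>i\<in>I \<times> J. linear (case i of (i, j) \<Rightarrow> \<lambda>h. D i h * G j x + F i x * E j h)"
    by auto
  fix e :: real assume e: "e > 0"
  have 1: "\<forall>\<^sub>F y in nhds x. \<forall>i\<in>I. \<bar>F i y - F i x - D i (y - x)\<bar> \<le> e / (3 * C) * norm (y - x)"
    "\<forall>\<^sub>F y in nhds x. \<forall>i\<in>J. \<bar>G i y - G i x - E i (y - x)\<bar> \<le> e / (3 * B) * norm (y - x)"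
    by (rule equidiff_atD[OF F(2)] equidiff_atD[OF G(2)]; use e B(1) C(1) in simp)+
  have 2: "\<forall>\<^sub>F y in nhds x. \<forall>i\<in>J. \<bar>G i y - G i x\<bar> \<le> e / (3 * (\<bar>B1\<bar> + 1))"
    using equidiff_at_equicont[OF G(2)] e unfolding equicont_at_def by (simp add: divide_pos_pos)
  from 1 2 show "\<forall>\<^sub>F y in nhds x. \<forall>i\<in>I \<times> J.
      \<bar>(case i of (i, j) \<Rightarrow> \<lambda>x. F i x * G j x) y - (case i of (i, j) \<Rightarrow> \<lambda>x. F i x * G j x) x -
        (case i of (i, j) \<Rightarrow> \<lambda>h. D i h * G j x + F i x * E j h) (y - x)\<bar> \<le> e * norm (y - x)"
    using C(2)
  proof eventually_elim
    case (elim y)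
    have "\<bar>F i y * G j y - F i x * G j x - (D i (y - x) * G j x + F i x * E j (y - x))\<bar> \<le> e * norm (y - x)"
      if ij: "i \<in> I" "j \<in> J" for i j
    proof -
      \<comment> \<open>Discrete product rule: two remainders and a cross term, each at most a third
        of the error. The cross term is small because \<open>G\<close>, being equidifferentiable, is
        equicontinuous.\<close>
      have "F i y * G j y - F i x * G j x - (D i (y - x) * G j x + F i x * E j (y - x)) =
          (F i y - F i x - D i (y - x)) * G j y + F i x * (G j y - G j x - E j (y - x))
          + D i (y - x) * (G j y - G j x)"
        by (simp add: algebra_simps)
      also have "\<bar>\<dots>\<bar> \<le> \<bar>F i y - F i x - D i (y - x)\<bar> * \<bar>G j y\<bar> + \<bar>F i x\<bar> * \<bar>G j y - G j x - E j (y - x)\<bar>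
          + \<bar>D i (y - x)\<bar> * \<bar>G j y - G j x\<bar>"
        unfolding abs_mult[symmetric] by linarith
      also have "\<dots> \<le> e / (3 * C) * norm (y - x) * C + B * (e / (3 * B) * norm (y - x))
          + (\<bar>B1\<bar> + 1) * norm (y - x) * (e / (3 * (\<bar>B1\<bar> + 1)))"
      proof (intro add_mono mult_mono)
        have "\<bar>D i (y - x)\<bar> \<le> B1 * norm (y - x)" using BC1 ij by blast
        also have "\<dots> \<le> (\<bar>B1\<bar> + 1) * norm (y - x)" by (intro mult_right_mono) auto
        finally show "\<bar>D i (y - x)\<bar> \<le> (\<bar>B1\<bar> + 1) * norm (y - x)" .
      qed (use elim ij Bx e B(1) C(1) in auto)
      also have "\<dots> = e / 3 * norm (y - x) + e / 3 * norm (y - x) + e / 3 * norm (y - x)"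
        using B(1) C(1) by (simp add: field_simps)
      also have "\<dots> = e * norm (y - x)" by simp
      finally show ?thesis .
    qed
    then show ?case by auto
  qed
qed

text \<open>By the product rule a derivative is a sum of two products in which one factor stays
  undifferentiated. The induction hypothesis applies to each product, the undifferentiated factor
  being lowered to order k by \<open>equi_Ck_Suc\<close>.\<close>

lemma equi_Ck_mult:
  assumes "open U" "equi_Ck k S U" "equi_Ck k T U"
  shows "equi_Ck k ((\<lambda>(f,g) x. f x * g x) ` (S \<times> T)) U"
  using assms(2,3)
proof (induction k arbitrary: S T)
  case 0
  show ?case
    by (intro equi_Ck_0I equibounded_at_mult equicont_at_mult) (use 0 in auto)
next
  case (Suc k)
  let ?S = "\<lambda>S. {\<lambda>x. frechet_derivative f (at x) v |f v::'a. f \<in> S \<and> norm v \<le> 1}"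
  let ?P = "\<lambda>S T. (\<lambda>(f,g) x. f x * g x) ` (S \<times> T) :: ('a \<Rightarrow> real) set"
  let ?T = "(\<lambda>(f,g) x. f x + g x) ` (?P (?S S) T \<times> ?P S (?S T))"
  show ?case
  proof (rule equi_Ck_SucI[OF assms(1), where T = ?T and
        D = "\<lambda>(f,g) x h. frechet_derivative f (at x) h * g x + f x * frechet_derivative g (at x) h"])
    fix x assume x: "x \<in> U"
    show "equibounded_at (S \<times> T) (\<lambda>(f, g) x. f x * g x) x"
      by (intro equibounded_at_mult equi_Ck_equibounded[OF Suc(2) x] equi_Ck_equibounded[OF Suc(3) x])
    show "equidiff_at (S \<times> T) (\<lambda>(f, g) x. f x * g x)
        (\<lambda>i. (case i of (f, g) \<Rightarrow> \<lambda>x h. frechet_derivative f (at x) h * g x + f x * frechet_derivative g (at x) h) x) x"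
      using equidiff_at_mult[of S "\<lambda>f. f" x "\<lambda>f. frechet_derivative f (at x)" T "\<lambda>f. f" "\<lambda>f. frechet_derivative f (at x)"]
        Suc(2,3) x by (simp add: case_prod_unfold)
  next
    show "equi_Ck k ?T U"
      using Suc(2,3) equi_Ck_Suc by (intro equi_Ck_add[OF assms(1)] Suc(1)) auto
  next
    fix i v assume i: "i \<in> S \<times> T" "norm (v::'a) \<le> 1"
    obtain f g where fg: "i = (f, g)" by (cases i)
    have "(\<lambda>(f,g) x. f x + g x) ((\<lambda>(f,g) x. f x * g x) (\<lambda>x. frechet_derivative f (at x) v, g),
        (\<lambda>(f,g) x. f x * g x) (f, \<lambda>x. frechet_derivative g (at x) v)) \<in> ?T"
      by (intro imageI SigmaI) (use i fg in blast)+
    then show "\<exists>h\<in>?T. \<forall>x\<in>U. (case i of (f, g) \<Rightarrow> \<lambda>x h. frechet_derivative f (at x) h * g x + f x * frechet_derivative g (at x) h) x v = h x"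
      by (rule bexI[rotated]) (simp add: fg)
  qed
qed

lemma equicont_at_compose:
  assumes "equicont_at I F (k x)" "isCont k x"
  shows "equicont_at I (\<lambda>i x. F i (k x)) x"
  unfolding equicont_at_def
proof (intro allI impI)
  fix e :: real assume "e > 0"
  then have "\<forall>\<^sub>F z in nhds (k x). \<forall>i\<in>I. \<bar>F i z - F i (k x)\<bar> \<le> e"
    using assms unfolding equicont_at_def by blast
  moreover have "filterlim k (nhds (k x)) (nhds x)"
    using assms(2) by (simp add: isCont_def tendsto_at_iff_tendsto_nhds)
  ultimately show "\<forall>\<^sub>F y in nhds x. \<forall>i\<in>I. \<bar>F i (k y) - F i (k x)\<bar> \<le> e"
    by (rule eventually_compose_filterlim)
qed

lemma equidiff_at_compose:
  assumes F: "equidiff_at I F D (k x)" and k: "(k has_derivative K) (at x)"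
  shows "equidiff_at I (\<lambda>i x. F i (k x)) (\<lambda>i h. D i (K h)) x"
  unfolding equidiff_at_def
proof (intro conjI allI impI)
  have K: "bounded_linear K" using k by (rule has_derivative_bounded_linear)
  obtain C where C: "C > 0" "\<And>h. norm (K h) \<le> norm h * C"
    using bounded_linear.pos_bounded[OF K] by blast
  obtain B where B: "\<forall>i\<in>I. \<forall>h. \<bar>D i h\<bar> \<le> B * norm h"
    using F unfolding equidiff_at_def by blast
  have B': "\<bar>D i h\<bar> \<le> (\<bar>B\<bar> + 1) * norm h" if "i \<in> I" for i h
  proof -
    have "\<bar>D i h\<bar> \<le> B * norm h" using B that by blast
    also have "\<dots> \<le> (\<bar>B\<bar> + 1) * norm h" by (intro mult_right_mono) auto
    finally show ?thesis .
  qed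
  have "\<bar>D i (K h)\<bar> \<le> ((\<bar>B\<bar> + 1) * C) * norm h" if "i \<in> I" for i h
  proof -
    have "\<bar>D i (K h)\<bar> \<le> (\<bar>B\<bar> + 1) * norm (K h)" using B' that by blast
    also have "\<dots> \<le> (\<bar>B\<bar> + 1) * (norm h * C)" using C by (intro mult_left_mono) auto
    finally show ?thesis by (simp add: mult_ac)
  qed
  then show "\<exists>B. \<forall>i\<in>I. \<forall>h. \<bar>D i (K h)\<bar> \<le> B * norm h" by blast
  have lin: "linear (D i)" if "i \<in> I" for i
    using F that unfolding equidiff_at_def by blast
  show "\<forall>i\<in>I. linear (\<lambda>h. D i (K h))"
    using lin linear_compose[OF bounded_linear.linear[OF K]] by (auto simp: o_def)
  fix e :: real assume e: "e > 0"
  \<comment> \<open>Each of the two errors contributes e / 2. \<open>e1\<close> absorbs the local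
    Lipschitz factor C + 1 of k, which comes from \<open>e2\<close> \<le> 1; the other bound on
    \<open>e2\<close> absorbs the common bound of the D i.\<close>
  define e1 where "e1 = e / (2 * (C + 1))"
  define e2 where "e2 = min 1 (e / (2 * (\<bar>B\<bar> + 1)))"
  have e12: "e1 > 0" "e2 > 0" unfolding e1_def e2_def using e C by auto
  have "\<forall>\<^sub>F z in nhds (k x). \<forall>i\<in>I. \<bar>F i z - F i (k x) - D i (z - k x)\<bar> \<le> e1 * norm (z - k x)"
    using F e12 unfolding equidiff_at_def by blast
  moreover have "filterlim k (nhds (k x)) (nhds x)"
    using has_derivative_continuous[OF k] by (simp add: isCont_def tendsto_at_iff_tendsto_nhds)
  ultimately have "\<forall>\<^sub>F y in nhds x. \<forall>i\<in>I. \<bar>F i (k y) - F i (k x) - D i (k y - k x)\<bar> \<le> e1 * norm (k y - k x)"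
    by (rule eventually_compose_filterlim)
  moreover have "\<forall>\<^sub>F y in nhds x. norm (k y - k x - K (y - x)) \<le> e2 * norm (y - x)"
    using k e12 unfolding has_derivative_at_alt eventually_nhds_metric dist_norm by blast
  ultimately show "\<forall>\<^sub>F y in nhds x. \<forall>i\<in>I. \<bar>F i (k y) - F i (k x) - D i (K (y - x))\<bar> \<le> e * norm (y - x)"
  proof eventually_elim
    case (elim y)
    show ?case
    proof
      fix i assume i: "i \<in> I"
      have "norm (k y - k x) \<le> norm (k y - k x - K (y - x)) + norm (K (y - x))"
        using norm_triangle_ineq[of "k y - k x - K (y - x)" "K (y - x)"] by simp
      also have "\<dots> \<le> 1 * norm (y - x) + norm (y - x) * C"
      proof (intro add_mono C(2) order_trans[OF elim(2)] mult_right_mono)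
        show "e2 \<le> 1" unfolding e2_def by simp
      qed simp
      finally have 1: "norm (k y - k x) \<le> (C + 1) * norm (y - x)" by (simp add: algebra_simps)
      have "F i (k y) - F i (k x) - D i (K (y - x)) =
          (F i (k y) - F i (k x) - D i (k y - k x)) + D i (k y - k x - K (y - x))"
        using linear_diff[OF lin[OF i]] by simp
      also have "\<bar>\<dots>\<bar> \<le> e1 * norm (k y - k x) + (\<bar>B\<bar> + 1) * norm (k y - k x - K (y - x))"
        by (rule order_trans[OF abs_triangle_ineq]) (intro add_mono B'[OF i] elim(1)[rule_format, OF i])
      also have "\<dots> \<le> e1 * ((C + 1) * norm (y - x)) + (\<bar>B\<bar> + 1) * (e / (2 * (\<bar>B\<bar> + 1)) * norm (y - x))"
      proof (intro add_mono mult_left_mono 1 order_trans[OF elim(2)] mult_right_mono)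
        show "e2 \<le> e / (2 * (\<bar>B\<bar> + 1))" unfolding e2_def by simp
      qed (use e12 in auto)
      also have "\<dots> = e / 2 * norm (y - x) + e / 2 * norm (y - x)"
      proof -
        have "e1 * (C + 1) = e / 2" "(\<bar>B\<bar> + 1) * (e / (2 * (\<bar>B\<bar> + 1))) = e / 2"
          unfolding e1_def using C(1) by (simp_all add: divide_simps)
        then show ?thesis by (metis mult.assoc)
      qed
      also have "\<dots> = e * norm (y - x)" by simp
      finally show "\<bar>F i (k y) - F i (k x) - D i (K (y - x))\<bar> \<le> e * norm (y - x)" .
    qed
  qed
qed

lemma equi_Ck_has_derivative:
  "equi_Ck (Suc k) S U \<Longrightarrow> f \<in> S \<Longrightarrow> x \<in> U \<Longrightarrow> (f has_derivative frechet_derivative f (at x)) (at x)"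
  using equidiff_at_has_derivative[of S "\<lambda>f. f"] by auto

lemma equi_Ck_isCont:
  assumes "equi_Ck k {f} U" "x \<in> U"
  shows "isCont f x"
  unfolding isCont_def tendsto_at_iff_tendsto_nhds
proof (rule tendstoI)
  fix e :: real assume e: "e > 0"
  have "equicont_at {f} (\<lambda>f. f) x" using assms by (rule equi_Ck_equicont)
  then have "\<forall>\<^sub>F y in nhds x. \<forall>f\<in>{f}. \<bar>f y - f x\<bar> \<le> e / 2"
    using e half_gt_zero unfolding equicont_at_def by blast
  then show "\<forall>\<^sub>F y in nhds x. dist (f y) (f x) < e"
    by eventually_elim (use e in \<open>auto simp: dist_norm\<close>)
qed

text \<open>For inner functions of this special form every directional derivative of the composite is a
  polynomial expression in real-valued functions of the same kind, so that the induction stays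
  within one type.\<close>

lemma pointwise_mult_memI:
  "f \<in> S \<Longrightarrow> g \<in> T \<Longrightarrow> (\<lambda>x. f x * g x) \<in> (\<lambda>(f,g) x. f x * g x) ` (S \<times> T)"
  by (rule image_eqI[of _ _ "(f, g)"]) auto

lemma pointwise_add_memI:
  "f \<in> S \<Longrightarrow> g \<in> T \<Longrightarrow> (\<lambda>x. f x + g x) \<in> (\<lambda>(f,g) x. f x + g x) ` (S \<times> T)"
  by (rule image_eqI[of _ _ "(f, g)"]) auto

lemma equi_Ck_compose:
  fixes L :: "'a::real_normed_vector \<Rightarrow> 'b::real_normed_vector"
  assumes "open U" "open V" "bounded_linear L"
    and "\<And>x. x \<in> U \<Longrightarrow> c + L x + \<phi> x *\<^sub>R w \<in> V"
    and "equi_Ck n {\<phi>} U" "equi_Ck n S V"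
  shows "equi_Ck n ((\<lambda>f x. f (c + L x + \<phi> x *\<^sub>R w)) ` S) U"
  using assms(5,6)
proof (induction n arbitrary: S)
  case 0
  show ?case
  proof (rule equi_Ck_0I)
    fix x assume x: "x \<in> U"
    show "equibounded_at S (\<lambda>f x. f (c + L x + \<phi> x *\<^sub>R w)) x"
      using equi_Ck_equibounded[OF 0(2) assms(4)[OF x]] unfolding equibounded_at_def .
    have "isCont (\<lambda>x. c + L x + \<phi> x *\<^sub>R w) x"
      by (intro isCont_add isCont_scaleR continuous_const linear_continuous_at assms(3) equi_Ck_isCont[OF 0(1) x])
    with equi_Ck_equicont[OF 0(2) assms(4)[OF x]]
    show "equicont_at S (\<lambda>f x. f (c + L x + \<phi> x *\<^sub>R w)) x"
      by (rule equicont_at_compose)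
  qed
next
  case (Suc n)
  let ?k = "\<lambda>x. c + L x + \<phi> x *\<^sub>R w"
  let ?D = "\<lambda>S. {\<lambda>x. frechet_derivative f (at x) v |f v. f \<in> S \<and> norm v \<le> 1}"
  let ?P = "\<lambda>S T. (\<lambda>(f,g) x. f x * g x) ` (S \<times> T) :: ('a \<Rightarrow> real) set"
  let ?C = "\<lambda>M. (\<lambda>c x. c) ` {c. \<bar>c\<bar> \<le> M} :: ('a \<Rightarrow> real) set"
  let ?R = "(\<lambda>f x. f (?k x)) ` {\<lambda>x. frechet_derivative f (at x) v |f v. f \<in> S \<and> norm v \<le> 1}"
  obtain M where M: "M > 0" "\<And>h. norm (L h) \<le> norm h * M"
    using bounded_linear.pos_bounded[OF assms(3)] by blast
  let ?S\<phi> = "{\<lambda>x. frechet_derivative f (at x) v |f v. f \<in> {\<phi>} \<and> norm v \<le> 1}"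
  \<comment> \<open>The derivative of f(k x) in direction v is f'(k x)(L v) + (\<phi>'(x) v) f'(k
    x)(w). Neither L v nor w depends on x, so both summands are products of real-valued families to
    which the induction hypothesis and the closure lemmas apply.\<close>
  let ?T = "(\<lambda>(f,g) x. f x + g x) ` (?P (?C M) ?R \<times> ?P ?S\<phi> (?P (?C (norm w + 1)) ?R))"
  let ?K = "\<lambda>x h. L h + frechet_derivative \<phi> (at x) h *\<^sub>R w"
  have k: "(?k has_derivative ?K x) (at x)" if "x \<in> U" for x
    using equi_Ck_has_derivative[OF Suc(2) _ that]
    by (auto intro!: derivative_eq_intros bounded_linear_imp_has_derivative assms(3))
  show ?case
  proof (rule equi_Ck_SucI[OF assms(1), where T = ?T and
        D = "\<lambda>f x h. frechet_derivative f (at (?k x)) (?K x h)"])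
    fix x assume x: "x \<in> U"
    show "equibounded_at S (\<lambda>f x. f (?k x)) x"
      using equi_Ck_equibounded[OF Suc(3) assms(4)[OF x]] unfolding equibounded_at_def .
    show "equidiff_at S (\<lambda>f x. f (?k x)) (\<lambda>f h. frechet_derivative f (at (?k x)) (?K x h)) x"
      by (rule equidiff_at_compose[OF _ k[OF x]]) (use Suc(3) assms(4)[OF x] in auto)
  next
    show "equi_Ck n ?T U"
      using Suc(2,3) by (intro equi_Ck_add equi_Ck_mult equi_Ck_const assms(1) Suc(1) equi_Ck_Suc[OF Suc(2)]) auto
  next
    fix f and v :: 'a assume f: "f \<in> S" and v: "norm v \<le> 1"
    \<comment> \<open>L v and w may be longer than 1, while \<open>?R\<close> holds only derivatives
      in directions of norm at most 1. They are scaled down and the factors M and norm w + 1 go into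
      constant families; the added 1 covers w = 0.\<close>
    let ?u = "L v /\<^sub>R M" and ?z = "w /\<^sub>R (norm w + 1)"
    have "norm ?u \<le> 1"
    proof -
      have "norm (L v) \<le> norm v * M" by (rule M)
      also have "\<dots> \<le> 1 * M" by (rule mult_right_mono) (use v M(1) in auto)
      finally show ?thesis using M(1) by (simp add: field_simps)
    qed
    then have u: "(\<lambda>x. frechet_derivative f (at (?k x)) ?u) \<in> ?R"
      by (intro image_eqI[of _ _ "\<lambda>x. frechet_derivative f (at x) ?u"] refl) (use f in blast)
    have "norm w + 1 > 0" using norm_ge_zero[of w] by linarith
    then have "norm ?z \<le> 1" by (simp add: divide_simps)
    then have z: "(\<lambda>x. frechet_derivative f (at (?k x)) ?z) \<in> ?R"
      by (intro image_eqI[of _ _ "\<lambda>x. frechet_derivative f (at x) ?z"] refl) (use f in blast)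
    define g1 where "g1 = (\<lambda>x. M * frechet_derivative f (at (?k x)) ?u)"
    define g2 where "g2 = (\<lambda>x. (norm w + 1) * frechet_derivative f (at (?k x)) ?z)"
    define g3 where "g3 = (\<lambda>x. frechet_derivative \<phi> (at x) v * g2 x)"
    have "(\<lambda>x. M) \<in> ?C M" using M(1) by (intro image_eqI[of _ _ M]) auto
    from pointwise_mult_memI[OF this u] have g1: "g1 \<in> ?P (?C M) ?R" unfolding g1_def .
    have "(\<lambda>x. norm w + 1) \<in> ?C (norm w + 1)" by (intro image_eqI[of _ _ "norm w + 1"]) auto
    from pointwise_mult_memI[OF this z] have g2: "g2 \<in> ?P (?C (norm w + 1)) ?R" unfolding g2_def .
    have "(\<lambda>x. frechet_derivative \<phi> (at x) v) \<in> ?S\<phi>" using v by blast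
    from pointwise_mult_memI[OF this g2] have g3: "g3 \<in> ?P ?S\<phi> (?P (?C (norm w + 1)) ?R)"
      unfolding g3_def .
    have mem: "(\<lambda>x. g1 x + g3 x) \<in> ?T" by (rule pointwise_add_memI[OF g1 g3])
    have "\<forall>x\<in>U. frechet_derivative f (at (?k x)) (?K x v) = g1 x + g3 x"
    proof
      fix x assume x: "x \<in> U"
      have lin: "linear (frechet_derivative f (at (?k x)))"
        using equi_Ck_has_derivative[OF Suc(3) f assms(4)[OF x]] has_derivative_linear by blast
      have "norm w + 1 \<noteq> 0" using norm_ge_zero[of w] by linarith
      then show "frechet_derivative f (at (?k x)) (?K x v) = g1 x + g3 x"
        using M(1) by (simp add: mult.assoc[symmetric] g1_def g2_def g3_def linear_add[OF lin] linear_scale[OF lin])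
    qed
    then show "\<exists>g\<in>?T. \<forall>x\<in>U. frechet_derivative f (at (?k x)) (?K x v) = g x"
      using mem by (rule bexI)
  qed
qed

section \<open>Equi-smoothness and the multilinear derivatives of Ck_on\<close>

lemma mnorm_bounds:
  assumes "\<And>v. \<forall>i<j. norm (v i) \<le> 1 \<Longrightarrow> norm (L v) \<le> e"
  shows "0 \<le> mnorm j L" "mnorm j L \<le> e"
proof -
  have ne: "(\<lambda>_. 0) \<in> {v. \<forall>i<j. norm (v i :: 'a) \<le> 1}" by simp
  have "bdd_above ((\<lambda>v. norm (L v)) ` {v. \<forall>i<j. norm (v i) \<le> 1})"
    using assms by (intro bdd_aboveI[of _ e]) auto
  from cSUP_upper[OF ne this] show "0 \<le> mnorm j L"
    unfolding mnorm_def using norm_ge_zero order_trans by blast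
  show "mnorm j L \<le> e"
    unfolding mnorm_def
  proof (rule cSUP_least)
    show "{v. \<forall>i<j. norm (v i :: 'a) \<le> 1} \<noteq> {}" using ne by (metis empty_iff)
  qed (use assms in simp)
qed

text \<open>\<open>mnorm\<close> is a real supremum and says nothing about an unbounded set, so a
  bound B has to be supplied first.\<close>

lemma norm_le_mnorm:
  assumes "\<And>v. \<forall>i<j. norm (v i) \<le> 1 \<Longrightarrow> norm (L v) \<le> B" "\<forall>i<j. norm (v i) \<le> 1"
  shows "norm (L v) \<le> mnorm j L"
proof -
  have "bdd_above ((\<lambda>v. norm (L v)) ` {v. \<forall>i<j. norm (v i) \<le> 1})"
    using assms by (intro bdd_aboveI[of _ B]) auto
  then show ?thesis
    unfolding mnorm_def by (rule cSUP_upper[rotated]) (use assms in simp)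
qed

lemma multilinear_bdd_unit_bound:
  assumes "multilinear_bdd j L"
  obtains B where "\<And>v. \<forall>i<j. norm (v i) \<le> 1 \<Longrightarrow> norm (L v) \<le> B"
proof -
  obtain C where C: "\<And>v. norm (L v) \<le> C * (\<Prod>i<j. norm (v i))"
    using assms unfolding multilinear_bdd_def by blast
  have "norm (L v) \<le> \<bar>C\<bar>" if "\<forall>i<j. norm (v i) \<le> 1" for v
  proof -
    have "norm (L v) \<le> C * (\<Prod>i<j. norm (v i))" by (rule C)
    also have "\<dots> \<le> \<bar>C\<bar> * 1"
      using that by (intro mult_mono prod_le_1 prod_nonneg) auto
    finally show ?thesis by simp
  qed
  then show thesis by (rule that)
qed

text \<open>Let \<open>S j\<close> consist of the functions x |-> D j x v with v 0, ..., v (j - 1)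
  in the unit ball. The derivative of such a function in a direction h of norm at most 1 is D (Suc
  j) x (v(j := h)), which belongs to \<open>S (Suc j)\<close>, and continuity of D k in
  \<open>mnorm\<close> makes \<open>S k\<close> equicontinuous. Hence \<open>S (k - m)\<close> has
  order m, by induction from the top derivative down.\<close>

lemma Ck_on_imp_equi_Ck:
  fixes f :: "'a::real_normed_vector \<Rightarrow> real"
  assumes U: "open U" and f: "Ck_on k f U"
  shows "equi_Ck k {f} U"
proof -
  obtain D where D: "(\<forall>x\<in>U. \<forall>v. D 0 x v = f x) \<and>
      (\<forall>j\<le>k. \<forall>x\<in>U. multilinear_bdd j (D j x)) \<and>
      (\<forall>j<k. \<forall>x\<in>U. ((\<lambda>h. mnorm j (\<lambda>v. D j (x + h) v - D j x v - D (Suc j) x (v(j := h))) / norm h)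
        \<longlongrightarrow> 0) (at 0)) \<and>
      (\<forall>x\<in>U. ((\<lambda>y. mnorm k (\<lambda>v. D k y v - D k x v)) \<longlongrightarrow> 0) (at x))"
    using f unfolding Ck_on_def by (elim exE)
  have D0: "\<And>x v. x \<in> U \<Longrightarrow> D 0 x v = f x"
    and ml: "\<And>j x. j \<le> k \<Longrightarrow> x \<in> U \<Longrightarrow> multilinear_bdd j (D j x)"
    and d: "\<And>j x. j < k \<Longrightarrow> x \<in> U \<Longrightarrow>
        ((\<lambda>h. mnorm j (\<lambda>v. D j (x + h) v - D j x v - D (Suc j) x (v(j := h))) / norm h) \<longlongrightarrow> 0) (at 0)"
    and c: "\<And>x. x \<in> U \<Longrightarrow> ((\<lambda>y. mnorm k (\<lambda>v. D k y v - D k x v)) \<longlongrightarrow> 0) (at x)"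
    using D by simp_all
  define I :: "nat \<Rightarrow> (nat \<Rightarrow> 'a) set" where "I j = {v. \<forall>i<j. norm (v i) \<le> 1}" for j
  define S where "S j = (\<lambda>v x. D j x v) ` I j" for j
  have b: "equibounded_at (I j) (\<lambda>v x. D j x v) x" if j: "j \<le> k" and x: "x \<in> U" for j x
  proof -
    obtain B where "\<And>v. \<forall>i<j. norm (v i) \<le> 1 \<Longrightarrow> norm (D j x v) \<le> B"
      using multilinear_bdd_unit_bound[OF ml[OF j x]] by blast
    then have "\<forall>v\<in>I j. \<bar>D j x v\<bar> \<le> B"
      unfolding I_def real_norm_def by blast
    then show ?thesis
      unfolding equibounded_at_def by (rule exI)
  qed
  have "equi_Ck m (S (k - m)) U" if "m \<le> k" for m
    using that
  proof (induction m)
    case 0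
    have "equi_Ck 0 ((\<lambda>v x. D k x v) ` I k) U"
    proof (rule equi_Ck_0I)
      fix x assume x: "x \<in> U"
      show "equibounded_at (I k) (\<lambda>v x. D k x v) x" using b x by simp
      show "equicont_at (I k) (\<lambda>v x. D k x v) x"
        unfolding equicont_at_def
      proof (intro allI impI)
        fix e :: real assume e: "e > 0"
        have "\<forall>\<^sub>F y in at x. mnorm k (\<lambda>v. D k y v - D k x v) < e"
          using order_tendstoD(2)[OF c[OF x] e] .
        then have "\<forall>\<^sub>F y in nhds x. y \<noteq> x \<longrightarrow> mnorm k (\<lambda>v. D k y v - D k x v) < e"
          by (simp add: eventually_at_filter)
        moreover have "\<forall>\<^sub>F y in nhds x. y \<in> U" using U x by (rule eventually_nhds_in_open)
        ultimately show "\<forall>\<^sub>F y in nhds x. \<forall>v\<in>I k. \<bar>D k y v - D k x v\<bar> \<le> e"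
        proof eventually_elim
          case (elim y)
          obtain B where B: "\<And>v. \<forall>i<k. norm (v i) \<le> 1 \<Longrightarrow> norm (D k y v) \<le> B"
            using multilinear_bdd_unit_bound[OF ml[OF order_refl elim(2)]] by blast
          obtain C where C: "\<And>v. \<forall>i<k. norm (v i) \<le> 1 \<Longrightarrow> norm (D k x v) \<le> C"
            using multilinear_bdd_unit_bound[OF ml[OF order_refl x]] by blast
          show ?case
          proof
            fix v assume v: "v \<in> I k"
            have "norm (D k y v - D k x v) \<le> mnorm k (\<lambda>v. D k y v - D k x v)"
            proof (rule norm_le_mnorm)
              fix v :: "nat \<Rightarrow> 'a" assume v: "\<forall>i<k. norm (v i) \<le> 1"
              show "norm (D k y v - D k x v) \<le> B + C"
                by (rule order_trans[OF norm_triangle_ineq4]) (intro add_mono B C v)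
            qed (use v I_def in auto)
            then show "\<bar>D k y v - D k x v\<bar> \<le> e" using elim(1) e by (cases "y = x") auto
          qed
        qed
      qed
    qed
    then show ?case unfolding S_def by simp
  next
    case (Suc m)
    define j where "j = k - Suc m"
    have j: "j < k" "k - m = Suc j" using Suc(2) unfolding j_def by auto
    have "equi_Ck (Suc m) ((\<lambda>v x. D j x v) ` I j) U"
    proof (rule equi_Ck_SucI[OF U, where T = "S (Suc j)" and D = "\<lambda>v x h. D (Suc j) x (v(j := h))"])
      fix x assume x: "x \<in> U"
      show "equibounded_at (I j) (\<lambda>v x. D j x v) x" using b x j by simp
      show "equidiff_at (I j) (\<lambda>v x. D j x v) (\<lambda>v h. D (Suc j) x (v(j := h))) x"
        unfolding equidiff_at_def
      proof (intro conjI allI impI)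
        have m: "multilinear_bdd (Suc j) (D (Suc j) x)" using ml j x by simp
        then show "\<forall>v\<in>I j. linear (\<lambda>h. D (Suc j) x (v(j := h)))"
          unfolding multilinear_bdd_def by blast
        obtain C where C: "\<And>v. norm (D (Suc j) x v) \<le> C * (\<Prod>i<Suc j. norm (v i))"
          using m unfolding multilinear_bdd_def by blast
        have le: "\<bar>D (Suc j) x (v(j := h))\<bar> \<le> \<bar>C\<bar> * norm h" if v: "v \<in> I j" for v h
        proof -
          have "(\<Prod>i<j. norm ((v(j := h)) i)) = (\<Prod>i<j. norm (v i))"
            by (intro prod.cong) auto
          also have "\<dots> \<le> 1" using v unfolding I_def by (intro prod_le_1) auto
          finally have "(\<Prod>i<Suc j. norm ((v(j := h)) i)) \<le> 1 * norm h"
            unfolding prod.lessThan_Suc by (intro mult_mono) auto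
          moreover have "0 \<le> (\<Prod>i<Suc j. norm ((v(j := h)) i))" by (intro prod_nonneg) auto
          ultimately have "C * (\<Prod>i<Suc j. norm ((v(j := h)) i)) \<le> \<bar>C\<bar> * (1 * norm h)"
            by (intro mult_mono) auto
          then show ?thesis using C[of "v(j := h)"] by simp
        qed
        then show "\<exists>B. \<forall>v\<in>I j. \<forall>h. \<bar>D (Suc j) x (v(j := h))\<bar> \<le> B * norm h" by blast
        fix e :: real assume e: "e > 0"
        let ?R = "\<lambda>h v. D j (x + h) v - D j x v - D (Suc j) x (v(j := h))"
        have "\<forall>\<^sub>F h in at 0. mnorm j (?R h) / norm h < e"
          using order_tendstoD(2)[OF d[OF j(1) x] e] .
        then obtain r where r: "r > 0" "\<And>h. h \<noteq> 0 \<Longrightarrow> norm h < r \<Longrightarrow> mnorm j (?R h) / norm h < e"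
          unfolding eventually_at by auto
        have "\<forall>\<^sub>F y in nhds x. dist y x < r"
          using r(1) unfolding eventually_nhds_metric by blast
        moreover have "\<forall>\<^sub>F y in nhds x. y \<in> U" using U x by (rule eventually_nhds_in_open)
        ultimately show "\<forall>\<^sub>F y in nhds x. \<forall>v\<in>I j. \<bar>D j y v - D j x v - D (Suc j) x (v(j := y - x))\<bar> \<le> e * norm (y - x)"
        proof eventually_elim
          case (elim y)
          define h where "h = y - x"
          have y: "y = x + h" unfolding h_def by simp
          have m1: "multilinear_bdd j (D j y)" "multilinear_bdd j (D j x)" using ml elim(2) x j by auto
          obtain B where B: "\<And>v. \<forall>i<j. norm (v i) \<le> 1 \<Longrightarrow> norm (D j y v) \<le> B"
            using multilinear_bdd_unit_bound[OF m1(1)] by blast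
          obtain B' where B': "\<And>v. \<forall>i<j. norm (v i) \<le> 1 \<Longrightarrow> norm (D j x v) \<le> B'"
            using multilinear_bdd_unit_bound[OF m1(2)] by blast
          show ?case
          proof
            fix v assume v: "v \<in> I j"
            have *: "norm (?R h v) \<le> mnorm j (?R h)"
            proof (rule norm_le_mnorm)
              fix v :: "nat \<Rightarrow> 'a" assume v: "\<forall>i<j. norm (v i) \<le> 1"
              show "norm (?R h v) \<le> B + B' + \<bar>C\<bar> * norm h"
                using B[OF v] B'[OF v] le[of v h] v unfolding y I_def real_norm_def by simp
            qed (use v I_def in auto)
            show "\<bar>D j y v - D j x v - D (Suc j) x (v(j := y - x))\<bar> \<le> e * norm (y - x)"
            proof (cases "h = 0")
              \<comment> \<open>The limit at 0 says nothing about h = 0; there the remainder is the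
                value of a linear map at 0.\<close>
              case True
              then show ?thesis using le[OF v, of 0] unfolding y by simp
            next
              case False
              then have "mnorm j (?R h) / norm h < e"
                using r(2) elim(1) unfolding h_def dist_norm by blast
              then have "mnorm j (?R h) \<le> e * norm h" using False by (simp add: field_simps)
              then show ?thesis using * unfolding y by simp
            qed
          qed
        qed
      qed
    next
      show "equi_Ck m (S (Suc j)) U" using Suc j by simp
    next
      fix v and h :: 'a assume "v \<in> I j" "norm h \<le> 1"
      then have "v(j := h) \<in> I (Suc j)" unfolding I_def by (auto simp: less_Suc_eq)
      then show "\<exists>g\<in>S (Suc j). \<forall>x\<in>U. D (Suc j) x (v(j := h)) = g x"
        unfolding S_def by (intro bexI[of _ "\<lambda>x. D (Suc j) x (v(j := h))"]) auto
    qed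
    then show ?case unfolding S_def j_def .
  qed
  from this[of k] have "equi_Ck k (S 0) U" by simp
  then show ?thesis
    by (rule equi_Ck_mono[OF U]) (auto simp: S_def I_def D0)
qed

text \<open>Canonical candidate for the maps D j in \<open>Ck_on\<close>. The newest direction sits
  in slot j, to match v(j := h) there; the derivative of order j ignores the slots from j
  on.\<close>

primrec iter_deriv :: "('a::real_normed_vector \<Rightarrow> real) \<Rightarrow> nat \<Rightarrow> 'a \<Rightarrow> (nat \<Rightarrow> 'a) \<Rightarrow> real" where
  "iter_deriv f 0 = (\<lambda>x v. f x)"
| "iter_deriv f (Suc j) = (\<lambda>x v. frechet_derivative (\<lambda>y. iter_deriv f j y v) (at x) (v j))"

lemma iter_deriv_local: "(\<And>i. i < j \<Longrightarrow> v i = w i) \<Longrightarrow> iter_deriv f j x v = iter_deriv f j x w"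
proof (induction j arbitrary: x)
  case (Suc j)
  have "(\<lambda>y. iter_deriv f j y v) = (\<lambda>y. iter_deriv f j y w)"
    using Suc by auto
  then show ?case using Suc(2) by simp
qed simp

lemma equi_Ck_iter_deriv:
  assumes "equi_Ck k {f} UNIV" "j \<le> k"
  shows "equi_Ck (k - j) {\<lambda>x. iter_deriv f j x v |v. \<forall>i<j. norm (v i) \<le> 1} UNIV"
  using assms(2)
proof (induction j)
  case 0
  then show ?case using assms by simp
next
  case (Suc j)
  let ?S = "{\<lambda>x. iter_deriv f j x v |v. \<forall>i<j. norm (v i) \<le> 1}"
  have "k - j = Suc (k - Suc j)" using Suc by simp
  then have "equi_Ck (k - Suc j) {\<lambda>x. frechet_derivative f (at x) v |f v. f \<in> ?S \<and> norm v \<le> 1} UNIV"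
    using Suc by simp
  then show ?case
  proof (rule equi_Ck_subset[OF open_UNIV])
    show "{\<lambda>x. iter_deriv f (Suc j) x v |v. \<forall>i<Suc j. norm (v i) \<le> 1} \<subseteq>
        {\<lambda>x. frechet_derivative f (at x) v |f v. f \<in> ?S \<and> norm v \<le> 1}"
      by (fastforce simp: less_Suc_eq)
  qed
qed

text \<open>\<open>equi_Ck\<close> controls only directions of norm at most 1; homogeneity in each
  slot extends boundedness and differentiability to all directions. If some v i with i < j is 0,
  both sides vanish.\<close>

lemma multilinear_normalize:
  fixes L :: "(nat \<Rightarrow> 'a::real_normed_vector) \<Rightarrow> real"
  assumes "\<And>v w. (\<And>i. i < j \<Longrightarrow> v i = w i) \<Longrightarrow> L v = L w"
    and lin: "\<And>i v. i < j \<Longrightarrow> linear (\<lambda>t. L (v(i := t)))"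
  shows "L v = (\<Prod>i<j. norm (v i)) * L (\<lambda>i. sgn (v i))"
proof -
  have "L v = (\<Prod>i<m. norm (v i)) * L (\<lambda>i. if i < m then sgn (v i) else v i)" if "m \<le> j" for m
    using that
  proof (induction m)
    case (Suc m)
    let ?u = "\<lambda>i. if i < m then sgn (v i) else v i"
    have "?u = ?u(m := norm (v m) *\<^sub>R sgn (v m))"
    proof
      have "v m = norm (v m) *\<^sub>R sgn (v m)"
        by (cases "v m = 0") (auto simp: sgn_div_norm)
      then show "?u i = (?u(m := norm (v m) *\<^sub>R sgn (v m))) i" for i
        by (cases "i = m") auto
    qed
    then have "L ?u = L (?u(m := norm (v m) *\<^sub>R sgn (v m)))" by simp
    also have "\<dots> = norm (v m) * L (?u(m := sgn (v m)))"
      using linear_scale[OF lin[of m ?u]] Suc by simp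
    also have "?u(m := sgn (v m)) = (\<lambda>i. if i < Suc m then sgn (v i) else v i)"
      by auto
    finally show ?case using Suc by simp
  qed simp
  from this[OF order_refl] show ?thesis
    using assms(1)[of "\<lambda>i. if i < j then sgn (v i) else v i" "\<lambda>i. sgn (v i)"] by simp
qed

text \<open>In the newest slot linearity is that of a Frechet derivative; in an older slot the
  linear identities of order j are differentiated. Both require differentiability for arbitrary v,
  which \<open>multilinear_normalize\<close> obtains from unit directions by means of multilinearity
  at order j.\<close>

lemma iter_deriv_multilinear:
  assumes f: "equi_Ck k {f} UNIV"
  shows "j \<le> k \<Longrightarrow> i < j \<Longrightarrow> linear (\<lambda>t. iter_deriv f j x (v(i := t)))"
proof (induction j arbitrary: i x v)
  case (Suc j)
  have diff: "(\<lambda>y. iter_deriv f j y v) differentiable at x" for v x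
  proof -
    have "equi_Ck (Suc (k - Suc j)) {\<lambda>x. iter_deriv f j x v |v. \<forall>i<j. norm (v i) \<le> 1} UNIV"
      using equi_Ck_iter_deriv[OF f, of j] Suc(2) by (simp add: Suc_diff_Suc)
    then have d: "equidiff_at {\<lambda>x. iter_deriv f j x v |v. \<forall>i<j. norm (v i) \<le> 1} (\<lambda>f. f) (\<lambda>f. frechet_derivative f (at x)) x"
      by simp
    have "(\<lambda>y. iter_deriv f j y (\<lambda>i. sgn (v i))) \<in> {\<lambda>x. iter_deriv f j x v |v. \<forall>i<j. norm (v i) \<le> 1}"
      by (auto simp: norm_sgn intro!: exI[of _ "\<lambda>i. sgn (v i)"])
    from equidiff_at_has_derivative[OF d this]
    have "(\<lambda>y. iter_deriv f j y (\<lambda>i. sgn (v i))) differentiable at x"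
      by (rule differentiableI)
    then have "(\<lambda>y. (\<Prod>i<j. norm (v i)) * iter_deriv f j y (\<lambda>i. sgn (v i))) differentiable at x"
      by (intro differentiable_mult differentiable_const)
    moreover have "iter_deriv f j y v = (\<Prod>i<j. norm (v i)) * iter_deriv f j y (\<lambda>i. sgn (v i))" for y
    proof (rule multilinear_normalize[of j "\<lambda>v. iter_deriv f j y v"])
      show "iter_deriv f j y v = iter_deriv f j y w" if "\<And>i. i < j \<Longrightarrow> v i = w i" for v w
        using that by (rule iter_deriv_local)
      show "linear (\<lambda>t. iter_deriv f j y (v(i := t)))" if "i < j" for i v
        by (rule Suc.IH) (use Suc that in auto)
    qed
    ultimately show ?thesis by simp
  qed
  show ?case
  proof (cases "i = j")
    case True
    have "(\<lambda>y. iter_deriv f j y (v(j := t))) = (\<lambda>y. iter_deriv f j y v)" for t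
      by (intro ext iter_deriv_local) auto
    then show ?thesis
      unfolding True iter_deriv.simps fun_upd_same using linear_frechet_derivative[OF diff] by simp
  next
    case False
    then have i: "i < j" using Suc by simp
    have lin: "linear (\<lambda>t. iter_deriv f j y (v(i := t)))" for y
      by (rule Suc.IH) (use Suc i in auto)
    have d: "((\<lambda>y. iter_deriv f j y (v(i := t))) has_derivative
        frechet_derivative (\<lambda>y. iter_deriv f j y (v(i := t))) (at x)) (at x)" for t
      using diff frechet_derivative_works by blast
    show ?thesis
    proof (rule linearI)
      fix s t
      have "((\<lambda>y. iter_deriv f j y (v(i := s + t))) has_derivative
          (\<lambda>h. frechet_derivative (\<lambda>y. iter_deriv f j y (v(i := s))) (at x) h
             + frechet_derivative (\<lambda>y. iter_deriv f j y (v(i := t))) (at x) h)) (at x)"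
        unfolding linear_add[OF lin] by (intro has_derivative_add d)
      from frechet_derivative_at[OF this, symmetric]
      show "iter_deriv f (Suc j) x (v(i := s + t)) = iter_deriv f (Suc j) x (v(i := s)) + iter_deriv f (Suc j) x (v(i := t))"
        using False by simp
    next
      fix c t
      have "((\<lambda>y. iter_deriv f j y (v(i := c *\<^sub>R t))) has_derivative
          (\<lambda>h. c *\<^sub>R frechet_derivative (\<lambda>y. iter_deriv f j y (v(i := t))) (at x) h)) (at x)"
        unfolding linear_scale[OF lin] by (intro has_derivative_scaleR_right d)
      from frechet_derivative_at[OF this, symmetric]
      show "iter_deriv f (Suc j) x (v(i := c *\<^sub>R t)) = c *\<^sub>R iter_deriv f (Suc j) x (v(i := t))"
        using False by simp
    qed
  qed
qed simp

lemma equi_Ck_imp_Ck_on: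
  assumes f: "equi_Ck k {f} UNIV"
  shows "Ck_on k f UNIV"
  unfolding Ck_on_def
proof (intro exI[of _ "iter_deriv f"] conjI ballI allI impI)
  let ?S = "\<lambda>j. {\<lambda>x. iter_deriv f j x v |v. \<forall>i<j. norm (v i) \<le> 1}"
  fix x
  show "iter_deriv f 0 x v = f x" for v by simp
  show "multilinear_bdd j (iter_deriv f j x)" if j: "j \<le> k" for j
    unfolding multilinear_bdd_def
  proof (intro conjI allI impI)
    show "iter_deriv f j x v = iter_deriv f j x w" if "\<forall>i<j. v i = w i" for v w
      using that by (intro iter_deriv_local) auto
    show lin: "linear (\<lambda>t. iter_deriv f j x (v(i := t)))" if "i < j" for i v
      using iter_deriv_multilinear[OF f j that] .
    have "equibounded_at (?S j) (\<lambda>f. f) x"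
      by (rule equi_Ck_equibounded[OF equi_Ck_iter_deriv[OF f j]]) simp
    then obtain B where B0: "\<forall>g\<in>?S j. \<bar>g x\<bar> \<le> B"
      unfolding equibounded_at_def by (elim exE)
    have B: "\<bar>iter_deriv f j x v\<bar> \<le> B" if "\<forall>i<j. norm (v i) \<le> 1" for v
      using bspec[OF B0, of "\<lambda>x. iter_deriv f j x v"] that by auto
    have "norm (iter_deriv f j x v) \<le> B * (\<Prod>i<j. norm (v i))" for v
    proof -
      have "iter_deriv f j x v = (\<Prod>i<j. norm (v i)) * iter_deriv f j x (\<lambda>i. sgn (v i))"
        by (rule multilinear_normalize[of j "iter_deriv f j x", OF iter_deriv_local lin])
      also have "norm \<dots> = (\<Prod>i<j. norm (v i)) * \<bar>iter_deriv f j x (\<lambda>i. sgn (v i))\<bar>"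
        by (simp add: abs_mult prod_nonneg)
      also have "\<dots> \<le> (\<Prod>i<j. norm (v i)) * B"
        by (intro mult_left_mono B prod_nonneg) (auto simp: norm_sgn)
      finally show ?thesis by (simp add: mult.commute)
    qed
    then show "\<exists>C. \<forall>v. norm (iter_deriv f j x v) \<le> C * (\<Prod>i<j. norm (v i))" by blast
  qed
  show "((\<lambda>h. mnorm j (\<lambda>v. iter_deriv f j (x + h) v - iter_deriv f j x v - iter_deriv f (Suc j) x (v(j := h))) / norm h)
      \<longlongrightarrow> 0) (at 0)" if j: "j < k" for j
  proof (rule tendstoI)
    fix e :: real assume e: "e > 0"
    have "equi_Ck (Suc (k - Suc j)) (?S j) UNIV"
      using equi_Ck_iter_deriv[OF f, of j] j by (simp add: Suc_diff_Suc)
    then have "equidiff_at (?S j) (\<lambda>f. f) (\<lambda>f. frechet_derivative f (at x)) x" by simp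
    then have "\<forall>\<^sub>F y in nhds x. \<forall>g\<in>?S j. \<bar>g y - g x - frechet_derivative g (at x) (y - x)\<bar> \<le> e / 2 * norm (y - x)"
      using e half_gt_zero unfolding equidiff_at_def by blast
    then obtain r where "r > 0 \<and> (\<forall>y. dist y x < r \<longrightarrow> (\<forall>g\<in>?S j.
        \<bar>g y - g x - frechet_derivative g (at x) (y - x)\<bar> \<le> e / 2 * norm (y - x)))"
      unfolding eventually_nhds_metric by (elim exE)
    then have r: "r > 0" "\<And>y g. dist y x < r \<Longrightarrow> g \<in> ?S j \<Longrightarrow>
        \<bar>g y - g x - frechet_derivative g (at x) (y - x)\<bar> \<le> e / 2 * norm (y - x)"
      by simp_all
    have "dist (mnorm j (\<lambda>v. iter_deriv f j (x + h) v - iter_deriv f j x v - iter_deriv f (Suc j) x (v(j := h))) / norm h) 0 < e"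
      if h: "h \<noteq> 0" "dist h 0 < r" for h
    proof -
      let ?R = "\<lambda>v. iter_deriv f j (x + h) v - iter_deriv f j x v - iter_deriv f (Suc j) x (v(j := h))"
      have le: "norm (?R v) \<le> e / 2 * norm h" if v: "\<forall>i<j. norm (v i) \<le> 1" for v
      proof -
        \<comment> \<open>Putting h into slot j changes the direction of differentiation but not the
          function that is differentiated.\<close>
        have "(\<lambda>y. iter_deriv f j y (v(j := h))) = (\<lambda>y. iter_deriv f j y v)"
          by (intro ext iter_deriv_local) auto
        then show ?thesis
          using r(2)[of "x + h" "\<lambda>y. iter_deriv f j y v"] h(2) v by (auto simp: dist_norm)
      qed
      have "0 \<le> mnorm j ?R" "mnorm j ?R \<le> e / 2 * norm h"
        using mnorm_bounds[of j ?R, OF le] by auto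
      moreover have "e / 2 * norm h < e * norm h" using e h by simp
      ultimately show ?thesis using h by (simp add: divide_less_eq)
    qed
    then show "\<forall>\<^sub>F h in at 0. dist (mnorm j (\<lambda>v. iter_deriv f j (x + h) v - iter_deriv f j x v - iter_deriv f (Suc j) x (v(j := h))) / norm h) 0 < e"
      unfolding eventually_at using r(1) by blast
  qed
  show "((\<lambda>y. mnorm k (\<lambda>v. iter_deriv f k y v - iter_deriv f k x v)) \<longlongrightarrow> 0) (at x)"
  proof (rule tendstoI)
    fix e :: real assume e: "e > 0"
    have "equicont_at (?S k) (\<lambda>f. f) x"
      by (rule equi_Ck_equicont[OF equi_Ck_iter_deriv[OF f order_refl]]) simp
    then have "\<forall>\<^sub>F y in nhds x. \<forall>g\<in>?S k. \<bar>g y - g x\<bar> \<le> e / 2"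
      using e half_gt_zero unfolding equicont_at_def by blast
    then have "\<forall>\<^sub>F y in nhds x. dist (mnorm k (\<lambda>v. iter_deriv f k y v - iter_deriv f k x v)) 0 < e"
    proof eventually_elim
      case (elim y)
      then have le: "norm (iter_deriv f k y v - iter_deriv f k x v) \<le> e / 2" if "\<forall>i<k. norm (v i) \<le> 1" for v
        using that by auto
      show ?case
        using mnorm_bounds[of k "\<lambda>v. iter_deriv f k y v - iter_deriv f k x v", OF le] e by simp
    qed
    then show "\<forall>\<^sub>F y in at x. dist (mnorm k (\<lambda>v. iter_deriv f k y v - iter_deriv f k x v)) 0 < e"
      by (simp add: eventually_at_filter eventually_mono)
  qed
qed

section \<open>Smooth cutoff functions\<close>

lemma equidiff_at_singleton:
  assumes "(f has_derivative D) (at x)"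
  shows "equidiff_at {i} (\<lambda>_. f) (\<lambda>_. D) x"
proof -
  have D: "bounded_linear D" using assms by (rule has_derivative_bounded_linear)
  obtain B where "\<And>h. norm (D h) \<le> norm h * B"
    using bounded_linear.bounded[OF D] by blast
  then have B: "\<exists>B. \<forall>h. \<bar>D h\<bar> \<le> B * norm h"
    by (intro exI[of _ B]) (simp add: mult.commute)
  have "\<forall>\<^sub>F y in nhds x. \<bar>f y - f x - D (y - x)\<bar> \<le> e * norm (y - x)" if "e > 0" for e
    using assms that unfolding has_derivative_at_alt eventually_nhds_metric dist_norm real_norm_def by blast
  then show ?thesis
    unfolding equidiff_at_def using B bounded_linear.linear[OF D] by simp
qed

lemma equi_Ck_0_singleton:
  assumes "\<And>x. x \<in> U \<Longrightarrow> isCont f x"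
  shows "equi_Ck 0 {f} U"
  unfolding equi_Ck.simps
proof (intro ballI conjI)
  fix x assume x: "x \<in> U"
  show "equibounded_at {f} (\<lambda>f. f) x" unfolding equibounded_at_def by auto
  show "equicont_at {f} (\<lambda>f. f) x"
    unfolding equicont_at_def
  proof (intro allI impI)
    fix e :: real assume e: "e > 0"
    have "(f \<longlongrightarrow> f x) (nhds x)"
      using assms[OF x] unfolding isCont_def tendsto_at_iff_tendsto_nhds .
    then have "\<forall>\<^sub>F y in nhds x. dist (f y) (f x) < e"
      using e by (rule tendstoD)
    then show "\<forall>\<^sub>F y in nhds x. \<forall>g\<in>{f}. \<bar>g y - g x\<bar> \<le> e"
      by eventually_elim (simp add: dist_norm)
  qed
qed

lemma equi_Ck_add_fun:
  "open U \<Longrightarrow> equi_Ck k {f} U \<Longrightarrow> equi_Ck k {g} U \<Longrightarrow> equi_Ck k {\<lambda>x. f x + g x} U"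
  using equi_Ck_add[of U k "{f}" "{g}"] by simp

lemma equi_Ck_mult_fun:
  "open U \<Longrightarrow> equi_Ck k {f} U \<Longrightarrow> equi_Ck k {g} U \<Longrightarrow> equi_Ck k {\<lambda>x. f x * g x} U"
  using equi_Ck_mult[of U k "{f}" "{g}"] by simp

lemma equi_Ck_const_fun: "open U \<Longrightarrow> equi_Ck k {\<lambda>x. c} U"
  by (rule equi_Ck_subset[OF _ equi_Ck_const[of U k "\<bar>c\<bar>"]]) auto

text \<open>The case L = 0 and w = 1 of \<open>equi_Ck_compose\<close>: a scalar inner function is a
  variable multiple of the vector 1.\<close>

lemma equi_Ck_compose_fun:
  fixes f :: "real \<Rightarrow> real"
  assumes "open U" "equi_Ck k {g} U" "equi_Ck k {f} UNIV"
  shows "equi_Ck k {\<lambda>x. f (g x)} U"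
  using equi_Ck_compose[of U UNIV "\<lambda>_. 0" 0 g 1 k "{f}"] assms by simp

lemma equi_Ck_compose_affine:
  assumes "bounded_linear L" "equi_Ck k {f} UNIV"
  shows "equi_Ck k {\<lambda>x. f (c + L x)} UNIV"
  using equi_Ck_compose[of UNIV UNIV L c "\<lambda>_. 0" 0 k "{f}"] assms by (simp add: equi_Ck_const_fun)

lemma equi_Ck_Suc_real:
  fixes f :: "real \<Rightarrow> real"
  assumes f: "\<And>x. (f has_real_derivative f' x) (at x)" and f': "equi_Ck k {f'} UNIV"
  shows "equi_Ck (Suc k) {f} UNIV"
proof -
  let ?T = "(\<lambda>(f,g) x. f x * g x) ` ((\<lambda>c x. c) ` {c. \<bar>c\<bar> \<le> 1} \<times> {f'}) :: (real \<Rightarrow> real) set"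
  have "equi_Ck (Suc k) ((\<lambda>_::unit. f) ` {()}) UNIV"
  proof (rule equi_Ck_SucI[where T = ?T and D = "\<lambda>_ x h. h * f' x"])
    show "equibounded_at {()} (\<lambda>_. f) x" for x unfolding equibounded_at_def by auto
    show "equidiff_at {()} (\<lambda>_. f) (\<lambda>_ h. h * f' x) x" for x
      using f[of x] by (intro equidiff_at_singleton) (simp add: has_field_derivative_def mult.commute[of _ "f' x"])
    show "equi_Ck k ?T UNIV"
      by (intro equi_Ck_mult equi_Ck_const f') auto
    fix v :: real assume v: "norm v \<le> 1"
    have "(\<lambda>x. v * f' x) \<in> ?T"
      by (rule pointwise_mult_memI) (use v in auto)
    then show "\<exists>g\<in>?T. \<forall>x\<in>UNIV. v * f' x = g x"
      by (rule bexI[rotated]) simp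
  qed auto
  then show ?thesis by simp
qed

lemma equi_Ck_ident_real: "equi_Ck k {\<lambda>x::real. x} UNIV"
proof (cases k)
  case 0
  then show ?thesis using equi_Ck_0_singleton[of UNIV "\<lambda>x::real. x"] by simp
next
  case (Suc n)
  show ?thesis
    unfolding Suc by (rule equi_Ck_Suc_real[where f' = "\<lambda>_. 1"]) (auto intro: equi_Ck_const_fun)
qed

text \<open>Differentiating exp(-1/t) t^(-n) produces the exponents n + 2 and n + 1. With all powers
  included the family is closed under differentiation up to linear combinations, so that smoothness
  follows by induction on the order for all n at once.\<close>

definition flat_exp :: "nat \<Rightarrow> real \<Rightarrow> real" where
  "flat_exp n t = (if t > 0 then exp (- inverse t) * inverse t ^ n else 0)"

lemma flat_exp_deriv:
  "(flat_exp n has_real_derivative flat_exp (n + 2) t - real n * flat_exp (n + 1) t) (at t)"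
proof -
  consider "t < 0" | "t = 0" | "t > 0" by linarith
  then show ?thesis
  proof cases
    case 1
    have "((\<lambda>_. 0) has_real_derivative 0) (at t)" by simp
    then have "(flat_exp n has_real_derivative 0) (at t)"
      by (rule DERIV_cong_ev[THEN iffD1, rotated -1])
        (use 1 in \<open>auto simp: flat_exp_def intro!: eventually_nhds_in_open[of "{..<0}", THEN eventually_mono]\<close>)
    then show ?thesis using 1 by (simp add: flat_exp_def)
  next
    case 2
    have "((\<lambda>h. flat_exp n h / h) \<longlongrightarrow> 0) (at_right 0)"
    proof -
      have "((\<lambda>h::real. inverse h ^ (n + 1) / exp (inverse h)) \<longlongrightarrow> 0) (at_right 0)"
        by (rule filterlim_compose[OF tendsto_power_div_exp_0 filterlim_inverse_at_top_right])
      moreover have "\<forall>\<^sub>F h in at_right 0. inverse h ^ (n + 1) / exp (inverse h) = flat_exp n h / h"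
        using eventually_at_right_less[of 0]
        by eventually_elim (simp add: flat_exp_def exp_minus field_simps)
      ultimately show ?thesis by (rule Lim_transform_eventually)
    qed
    moreover have "((\<lambda>h. flat_exp n h / h) \<longlongrightarrow> 0) (at_left 0)"
    proof (rule tendsto_eventually)
      show "\<forall>\<^sub>F h in at_left 0. flat_exp n h / h = 0"
        using eventually_at_left_real[of "-1" "0::real"] by (auto elim!: eventually_mono simp: flat_exp_def)
    qed
    ultimately have "((\<lambda>h. flat_exp n h / h) \<longlongrightarrow> 0) (at 0)"
      by (simp add: filterlim_at_split)
    then show ?thesis using 2 by (simp add: DERIV_def flat_exp_def)
  next
    case 3
    have "((\<lambda>t. exp (- inverse t) * inverse t ^ n) has_real_derivative
        flat_exp (n + 2) t - real n * flat_exp (n + 1) t) (at t)"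
      using 3 by (auto intro!: derivative_eq_intros simp: flat_exp_def power2_eq_square)
        (cases n; simp add: field_simps)
    then show ?thesis
      by (rule DERIV_cong_ev[THEN iffD1, rotated -1])
        (use 3 in \<open>auto simp: flat_exp_def intro!: eventually_nhds_in_open[of "{0<..}", THEN eventually_mono]\<close>)
  qed
qed

lemma equi_Ck_flat_exp: "equi_Ck k {flat_exp n} UNIV"
proof (induction k arbitrary: n)
  case 0
  show ?case by (rule equi_Ck_0_singleton) (rule DERIV_isCont[OF flat_exp_deriv])
next
  case (Suc k)
  have "equi_Ck k {\<lambda>t. flat_exp (n + 2) t + (- real n) * flat_exp (n + 1) t} UNIV"
    by (intro equi_Ck_add_fun equi_Ck_mult_fun equi_Ck_const_fun Suc) auto
  then show ?case
    by (intro equi_Ck_Suc_real[OF flat_exp_deriv]) simp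
qed

lemma flat_exp_pos: "t > 0 \<Longrightarrow> flat_exp n t > 0"
  and flat_exp_zero: "t \<le> 0 \<Longrightarrow> flat_exp n t = 0"
  and flat_exp_nonneg: "flat_exp n t \<ge> 0"
  by (auto simp: flat_exp_def)

lemma flat_exp_mono: "s \<le> t \<Longrightarrow> flat_exp 0 s \<le> flat_exp 0 t"
  by (auto simp: flat_exp_def)

text \<open>Write h for \<open>flat_exp 0\<close> and put i(t) = 1 - h(t - r) / h(R - r), b(t) =
  h(i(t)) / h(1). Then i is 1 up to r and falls strictly to 0 at R, beyond which h(i(t)) vanishes.
  The chain rule gives the strict sign of b' in between, which confines the critical points of the
  radial function.\<close>

lemma exists_smooth_cutoff:
  fixes r R :: real
  assumes "r < R"
  shows "\<exists>(b :: real \<Rightarrow> real) b' M. (\<forall>k. equi_Ck k {b} UNIV) \<and>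
    (\<forall>t. (b has_real_derivative b' t) (at t)) \<and> (\<forall>t\<le>r. b t = 1) \<and> (\<forall>t\<ge>R. b t = 0) \<and>
    (\<forall>t. 0 \<le> b t \<and> b t \<le> 1) \<and> (\<forall>t. r < t \<longrightarrow> t < R \<longrightarrow> b' t < 0) \<and>
    (\<forall>t\<ge>R. b' t = 0) \<and> (\<forall>t. \<bar>b' t\<bar> \<le> M)"
proof -
  define c where "c = inverse (flat_exp 0 (R - r))"
  define d where "d = inverse (flat_exp 0 1)"
  have c: "c > 0" and d: "d > 0" unfolding c_def d_def using assms flat_exp_pos by simp_all
  define i where "i t = 1 + (- c) * flat_exp 0 (- r + t)" for t
  define b where "b t = d * flat_exp 0 (i t)" for t
  define b' where "b' t = d * (flat_exp 2 (i t) * (- c * flat_exp 2 (- r + t)))" for t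
  have i1: "i t \<le> 1" for t unfolding i_def using c flat_exp_nonneg[of 0 "- r + t"] by simp
  have i2: "i t = 1" if "t \<le> r" for t unfolding i_def using that by (simp add: flat_exp_zero)
  have i3: "i t > 0" if "t < R" for t
  proof -
    have "flat_exp 0 (- r + t) < flat_exp 0 (R - r)"
      using that assms by (auto simp: flat_exp_def)
    then have "c * flat_exp 0 (- r + t) < c * flat_exp 0 (R - r)" using c by simp
    also have "\<dots> = 1" unfolding c_def using flat_exp_pos[of "R - r" 0] assms by simp
    finally show ?thesis unfolding i_def by simp
  qed
  have i4: "i t \<le> 0" if "t \<ge> R" for t
  proof -
    have "1 = c * flat_exp 0 (R - r)" unfolding c_def using flat_exp_pos[of "R - r" 0] assms by simp
    also have "\<dots> \<le> c * flat_exp 0 (- r + t)" using c that by (intro mult_left_mono flat_exp_mono) auto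
    finally show ?thesis unfolding i_def by simp
  qed
  have der: "(b has_real_derivative b' t) (at t)" for t
  proof -
    have f0: "(flat_exp 0 has_real_derivative flat_exp 2 t) (at t)" for t
      using flat_exp_deriv[of 0 t] by (simp add: numeral_2_eq_2)
    have "((\<lambda>t. flat_exp 0 (- r + t)) has_real_derivative flat_exp 2 (- r + t) * 1) (at t)"
      by (rule DERIV_chain2[OF f0]) (auto intro!: derivative_eq_intros)
    then have "(i has_real_derivative - c * flat_exp 2 (- r + t)) (at t)"
      unfolding i_def by (auto intro!: derivative_eq_intros)
    then have "((\<lambda>t. flat_exp 0 (i t)) has_real_derivative flat_exp 2 (i t) * (- c * flat_exp 2 (- r + t))) (at t)"
      by (rule DERIV_chain2[OF f0])
    then show ?thesis unfolding b_def b'_def by (rule DERIV_cmult)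
  qed
  have contb': "continuous_on UNIV b'"
  proof -
    have f: "continuous_on UNIV (flat_exp n)" for n
      by (meson DERIV_isCont flat_exp_deriv continuous_at_imp_continuous_on)
    have "continuous_on UNIV i"
      unfolding i_def by (intro continuous_intros continuous_on_compose2[OF f]) auto
    then show ?thesis
      unfolding b'_def by (intro continuous_intros continuous_on_compose2[OF f]) auto
  qed
  have zero: "b' t = 0" if "t \<ge> R" for t
    unfolding b'_def using i4[OF that] by (simp add: flat_exp_zero)
  have zero': "b' t = 0" if "t \<le> r" for t
    unfolding b'_def using that by (simp add: flat_exp_zero)
  have "compact (b' ` {r..R})"
    by (intro compact_continuous_image continuous_on_subset[OF contb']) auto
  then have "bounded (b' ` {r..R})" by (rule compact_imp_bounded)
  then obtain M where "\<forall>y\<in>b' ` {r..R}. norm y \<le> M" unfolding bounded_iff by (elim exE)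
  then have M: "norm (b' t) \<le> M" if "t \<in> {r..R}" for t using that by simp
  have bound: "\<bar>b' t\<bar> \<le> \<bar>M\<bar>" for t
  proof (cases "t \<in> {r..R}")
    case True
    then show ?thesis using M[of t] by simp
  next
    case False
    then have "b' t = 0" using zero[of t] zero'[of t] by (cases "t \<le> r") auto
    then show ?thesis by simp
  qed
  have sm: "equi_Ck k {b} UNIV" for k
  proof -
    have "equi_Ck k {\<lambda>t. flat_exp 0 (- r + t)} UNIV"
      by (intro equi_Ck_compose_affine equi_Ck_flat_exp bounded_linear_ident)
    then have "equi_Ck k {i} UNIV"
      unfolding i_def by (intro equi_Ck_add_fun equi_Ck_mult_fun equi_Ck_const_fun) auto
    then show ?thesis
      unfolding b_def
      by (rule equi_Ck_mult_fun[OF open_UNIV equi_Ck_const_fun[OF open_UNIV]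
            equi_Ck_compose_fun[OF open_UNIV _ equi_Ck_flat_exp]])
  qed
  show ?thesis
  proof (rule exI[of _ b], rule exI[of _ b'], rule exI[of _ "\<bar>M\<bar>"], intro conjI allI impI)
    show "equi_Ck k {b} UNIV" for k by (rule sm)
    show "(b has_real_derivative b' t) (at t)" for t by (rule der)
    show "b t = 1" if "t \<le> r" for t
      unfolding b_def d_def i2[OF that] using flat_exp_pos[of 1 0] by simp
    show "b t = 0" if "t \<ge> R" for t
      unfolding b_def using i4[OF that] by (simp add: flat_exp_zero)
    show "0 \<le> b t" for t unfolding b_def using d flat_exp_nonneg by simp
    have "b t \<le> d * flat_exp 0 1" for t
      unfolding b_def using d i1 by (intro mult_left_mono flat_exp_mono) auto
    then show "b t \<le> 1" for t unfolding d_def using flat_exp_pos[of 1 0] by simp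
    show "b' t < 0" if "r < t" "t < R" for t
    proof -
      have "d * (flat_exp 2 (i t) * (c * flat_exp 2 (- r + t))) > 0"
        using that i3 c d by (intro mult_pos_pos flat_exp_pos) auto
      then show ?thesis unfolding b'_def by simp
    qed
    show "b' t = 0" if "t \<ge> R" for t using zero that .
    show "\<bar>b' t\<bar> \<le> \<bar>M\<bar>" for t by (rule bound)
  qed
qed

text \<open>Take a(t) = b(j(t)^2) with b a cutoff between 1 and 2 and j(t) = (t - 1) / L. Squaring
  makes the cutoff two-sided. Where b' does not vanish, |j| \<le> 2 and the slope is at most 4 M /
  L, which is below 1 for L = 4 M + 1. The plateau |t - 1| \<le> L contains [0, 2] because L \<ge>
  1.\<close>

lemma exists_slow_cutoff:
  shows "\<exists>(a :: real \<Rightarrow> real) a' c. (\<forall>k. equi_Ck k {a} UNIV) \<and>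
    (\<forall>t. (a has_real_derivative a' t) (at t)) \<and> (\<forall>t. \<bar>a' t\<bar> < 1) \<and>
    (\<forall>t. 0 \<le> t \<longrightarrow> t \<le> 2 \<longrightarrow> a t = 1) \<and> (\<forall>t. 0 \<le> a t \<and> a t \<le> 1) \<and>
    c \<ge> 0 \<and> (\<forall>t. a t \<noteq> 0 \<longrightarrow> \<bar>t\<bar> \<le> c)"
proof -
  have "(1::real) < 2" by simp
  from exists_smooth_cutoff[OF this] obtain b b' :: "real \<Rightarrow> real" and M where
    "(\<forall>k. equi_Ck k {b} UNIV) \<and>
    (\<forall>t. (b has_real_derivative b' t) (at t)) \<and> (\<forall>t\<le>1. b t = 1) \<and> (\<forall>t\<ge>2. b t = 0) \<and>
    (\<forall>t. 0 \<le> b t \<and> b t \<le> 1) \<and> (\<forall>t. 1 < t \<longrightarrow> t < 2 \<longrightarrow> b' t < 0) \<and>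
    (\<forall>t\<ge>2. b' t = 0) \<and> (\<forall>t. \<bar>b' t\<bar> \<le> M)"
    by (elim exE)
  then have b: "\<And>k. equi_Ck k {b} UNIV" "\<And>t. (b has_real_derivative b' t) (at t)"
    "\<And>t. t \<le> 1 \<Longrightarrow> b t = 1" "\<And>t. t \<ge> 2 \<Longrightarrow> b t = 0" "\<And>t. 0 \<le> b t" "\<And>t. b t \<le> 1"
    "\<And>t. t \<ge> 2 \<Longrightarrow> b' t = 0" "\<And>t. \<bar>b' t\<bar> \<le> M"
    by simp_all
  have M: "M \<ge> 0" using b(8)[of 0] by linarith
  define L where "L = 4 * M + 1"
  have L: "L \<ge> 1" "4 * M < L" unfolding L_def using M by auto
  define j where "j t = - inverse L + t / L" for t
  have j: "j t = (t - 1) / L" for t unfolding j_def using L by (simp add: field_simps)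
  define a where "a t = b (j t * j t)" for t
  define a' where "a' t = b' (j t * j t) * (2 * j t / L)" for t
  have j2: "\<bar>j t\<bar> \<le> 2" if "j t * j t < 2" for t
  proof (rule ccontr)
    assume "\<not> \<bar>j t\<bar> \<le> 2"
    then have "2 * 2 < \<bar>j t\<bar> * \<bar>j t\<bar>" by (intro mult_strict_mono) auto
    then show False using that by (simp add: abs_mult[symmetric])
  qed
  show ?thesis
  proof (rule exI[of _ a], rule exI[of _ a'], rule exI[of _ "2 * L + 1"], intro conjI allI impI)
    show "equi_Ck k {a} UNIV" for k
    proof -
      have "equi_Ck k {j} UNIV"
        unfolding j_def by (rule equi_Ck_compose_affine[OF bounded_linear_divide equi_Ck_ident_real])
      then show ?thesis
        unfolding a_def by (intro equi_Ck_compose_fun[OF open_UNIV _ b(1)] equi_Ck_mult_fun open_UNIV)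
    qed
    show "(a has_real_derivative a' t) (at t)" for t
    proof -
      have "((\<lambda>t. j t * j t) has_real_derivative 2 * j t / L) (at t)"
      proof -
        have "(j has_real_derivative inverse L) (at t)"
          unfolding j_def using L by (auto intro!: derivative_eq_intros simp: field_simps)
        from DERIV_mult[OF this this] show ?thesis by (simp add: divide_inverse mult_ac)
      qed
      then show ?thesis unfolding a_def a'_def by (rule DERIV_chain2[OF b(2)])
    qed
    show "\<bar>a' t\<bar> < 1" for t
    proof (cases "j t * j t < 2")
      case True
      have "\<bar>a' t\<bar> = \<bar>b' (j t * j t)\<bar> * (2 * \<bar>j t\<bar> / L)"
        unfolding a'_def using L by (simp add: abs_mult)
      also have "\<dots> \<le> M * (2 * 2 / L)"
        using b(8) j2[OF True] L M by (intro mult_mono divide_right_mono) auto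
      also have "\<dots> < 1" using L by (simp add: field_simps)
      finally show ?thesis .
    next
      case False
      then show ?thesis unfolding a'_def using b(7) by simp
    qed
    show "a t = 1" if "0 \<le> t" "t \<le> 2" for t
    proof -
      have "\<bar>j t\<bar> \<le> 1" unfolding j using that L by (auto simp: abs_le_iff field_simps)
      then have "\<bar>j t\<bar> * \<bar>j t\<bar> \<le> 1 * 1" by (intro mult_mono) auto
      then show ?thesis unfolding a_def using b(3) by (simp add: abs_mult[symmetric])
    qed
    show "\<bar>t\<bar> \<le> 2 * L + 1" if "a t \<noteq> 0" for t
    proof -
      have "j t * j t < 2" using that b(4)[of "j t * j t"] unfolding a_def by (meson not_le)
      from j2[OF this] have "\<bar>t - 1\<bar> \<le> 2 * L" unfolding j using L by (simp add: abs_le_iff field_simps)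
      then show ?thesis by linarith
    qed
  qed (use b L in \<open>auto simp: a_def\<close>)
qed

section \<open>Norming functionals and triangular systems\<close>

definition sublinear :: "('a::real_vector \<Rightarrow> real) \<Rightarrow> bool" where
  "sublinear p \<longleftrightarrow> (\<forall>x y. p (x + y) \<le> p x + p y) \<and> (\<forall>x c. c \<ge> 0 \<longrightarrow> p (c *\<^sub>R x) \<le> c * p x)"

lemma sublinear_add: "sublinear p \<Longrightarrow> p (x + y) \<le> p x + p y"
  and sublinear_scale_le: "sublinear p \<Longrightarrow> c \<ge> 0 \<Longrightarrow> p (c *\<^sub>R x) \<le> c * p x"
  by (auto simp: sublinear_def)

lemma sublinear_0: "sublinear p \<Longrightarrow> p 0 = 0"
  using sublinear_add[of p 0 0] sublinear_scale_le[of p 0 0] by simp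

lemma sublinear_scale:
  assumes "sublinear p" "c \<ge> 0"
  shows "p (c *\<^sub>R x) = c * p x"
proof (cases "c = 0")
  case True
  then show ?thesis using sublinear_0[OF assms(1)] by simp
next
  case False
  then have "p x \<le> inverse c * p (c *\<^sub>R x)"
    using sublinear_scale_le[OF assms(1), of "inverse c" "c *\<^sub>R x"] assms(2) by simp
  then have "c * p x \<le> p (c *\<^sub>R x)" using False assms(2) by (simp add: field_simps)
  then show ?thesis using sublinear_scale_le[OF assms] by (simp add: antisym)
qed

lemma sublinear_minus: "sublinear p \<Longrightarrow> - p (- x) \<le> p x"
  using sublinear_add[of p x "- x"] sublinear_0[of p] by simp

text \<open>Let p'(x) be the infimum over t \<ge> 0 of p(x + t y) - t p(y). The choice t = 0 gives
  p' \<le> p and t = 1 gives the value at - y; subadditivity bounds the expression below by - p(-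
  x).\<close>

lemma sublinear_decrease:
  assumes p: "sublinear p"
  shows "\<exists>p'. sublinear p' \<and> (\<forall>x. p' x \<le> p x) \<and> p' (- y) \<le> - p y"
proof -
  define p' where "p' x = (INF t\<in>{0..}. p (x + t *\<^sub>R y) - t * p y)" for x
  have lower: "- p (- x) \<le> p (x + t *\<^sub>R y) - t * p y" if "t \<ge> 0" for x t
    using sublinear_add[OF p, of "- x" "x + t *\<^sub>R y"] sublinear_scale[OF p that, of y] by simp
  then have bdd: "bdd_below ((\<lambda>t. p (x + t *\<^sub>R y) - t * p y) ` {0..})" for x
    by (intro bdd_belowI[of _ "- p (- x)"]) auto
  have le: "p' x \<le> p (x + t *\<^sub>R y) - t * p y" if "t \<ge> 0" for x t
    unfolding p'_def by (rule cINF_lower[OF bdd]) (use that in auto)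
  have ge: "m \<le> p' x" if "\<And>t. t \<ge> 0 \<Longrightarrow> m \<le> p (x + t *\<^sub>R y) - t * p y" for m x
    unfolding p'_def by (rule cINF_greatest) (use that in auto)
  have "sublinear p'"
    unfolding sublinear_def
  proof (intro conjI allI impI)
    fix x z
    have "p' (x + z) - p' z \<le> p' x"
    proof (rule ge)
      fix t :: real assume t: "t \<ge> 0"
      have "p' (x + z) - (p (x + t *\<^sub>R y) - t * p y) \<le> p' z"
      proof (rule ge)
        fix s :: real assume s: "s \<ge> 0"
        have "p' (x + z) \<le> p (x + z + (t + s) *\<^sub>R y) - (t + s) * p y"
          using s t by (intro le) auto
        also have "p (x + z + (t + s) *\<^sub>R y) \<le> p (x + t *\<^sub>R y) + p (z + s *\<^sub>R y)"
          using sublinear_add[OF p, of "x + t *\<^sub>R y" "z + s *\<^sub>R y"] by (simp add: algebra_simps)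
        finally show "p' (x + z) - (p (x + t *\<^sub>R y) - t * p y) \<le> p (z + s *\<^sub>R y) - s * p y"
          by (simp add: algebra_simps)
      qed
      then show "p' (x + z) - p' z \<le> p (x + t *\<^sub>R y) - t * p y" by simp
    qed
    then show "p' (x + z) \<le> p' x + p' z" by simp
  next
    fix x and c :: real assume c: "c \<ge> 0"
    show "p' (c *\<^sub>R x) \<le> c * p' x"
    proof (cases "c = 0")
      case True
      then show ?thesis using le[of 0 0] sublinear_0[OF p] by simp
    next
      case False
      have "p' (c *\<^sub>R x) / c \<le> p' x"
      proof (rule ge)
        fix t :: real assume t: "t \<ge> 0"
        have "p' (c *\<^sub>R x) \<le> p (c *\<^sub>R x + (c * t) *\<^sub>R y) - (c * t) * p y"
          using c t by (intro le) auto
        also have "c *\<^sub>R x + (c * t) *\<^sub>R y = c *\<^sub>R (x + t *\<^sub>R y)" by (simp add: algebra_simps)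
        also have "p \<dots> = c * p (x + t *\<^sub>R y)" by (rule sublinear_scale[OF p c])
        finally have "p' (c *\<^sub>R x) \<le> c * (p (x + t *\<^sub>R y) - t * p y)"
          by (simp add: right_diff_distrib mult.assoc)
        then show "p' (c *\<^sub>R x) / c \<le> p (x + t *\<^sub>R y) - t * p y"
          using c False by (simp add: pos_divide_le_eq mult.commute)
      qed
      then show ?thesis using c False by (simp add: field_simps)
    qed
  qed
  moreover have "p' x \<le> p x" for x using le[of 0 x] by simp
  moreover have "p' (- y) \<le> - p y" using le[of 1 "- y"] sublinear_0[OF p] by simp
  ultimately show ?thesis by blast
qed

text \<open>Zorn's lemma for the reversed pointwise order. The pointwise infimum of a chain is
  finite, as every sublinear p below p0 satisfies - p0(- x) \<le> p x; it is subadditive because the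
  smaller of two members of the chain serves both summands.\<close>

lemma exists_minimal_sublinear:
  assumes p0: "sublinear p0"
  shows "\<exists>p. sublinear p \<and> (\<forall>x. p x \<le> p0 x) \<and> (\<forall>p'. sublinear p' \<longrightarrow> (\<forall>x. p' x \<le> p x) \<longrightarrow> p' = p)"
proof -
  define A where "A = {p. sublinear p \<and> (\<forall>x. p x \<le> p0 x)}"
  have "\<exists>m\<in>A. \<forall>a\<in>A. (\<forall>x. a x \<le> m x) \<longrightarrow> a = m"
  proof (rule predicate_Zorn)
    show "partial_order_on A (relation_of (\<lambda>a b. \<forall>x. b x \<le> a x) A)"
    proof (rule partial_order_on_relation_ofI)
      fix a b :: "'a \<Rightarrow> real" assume "\<forall>x. b x \<le> a x" "\<forall>x. a x \<le> b x"
      then show "a = b" by (auto intro: antisym)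
    qed (auto intro: order_trans)
    fix C assume C: "C \<in> Chains (relation_of (\<lambda>a b. \<forall>x. b x \<le> a x) A)"
    then have CA: "C \<subseteq> A" and total: "\<And>p r. p \<in> C \<Longrightarrow> r \<in> C \<Longrightarrow> (\<forall>x. r x \<le> p x) \<or> (\<forall>x. p x \<le> r x)"
      unfolding Chains_def relation_of_def by auto
    show "\<exists>u\<in>A. \<forall>a\<in>C. \<forall>x. u x \<le> a x"
    proof (cases "C = {}")
      case True
      then show ?thesis using p0 unfolding A_def by (intro bexI[of _ p0]) auto
    next
      case False
      define u where "u x = (INF p\<in>C. p x)" for x
      have sub: "sublinear p" and lep0: "p x \<le> p0 x" if "p \<in> C" for p x
        using CA that unfolding A_def by auto
      have "- p0 (- x) \<le> p x" if "p \<in> C" for p x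
        using sublinear_minus[OF sub[OF that], of x] lep0[OF that, of "- x"] by simp
      then have bdd: "bdd_below ((\<lambda>p. p x) ` C)" for x
        by (intro bdd_belowI[of _ "- p0 (- x)"]) auto
      have le: "u x \<le> p x" if "p \<in> C" for p x
        unfolding u_def by (rule cINF_lower[OF bdd that])
      have ge: "m \<le> u x" if "\<And>p. p \<in> C \<Longrightarrow> m \<le> p x" for m x
        unfolding u_def by (rule cINF_greatest[OF False that])
      have "sublinear u"
        unfolding sublinear_def
      proof (intro conjI allI impI)
        fix x y
        have "u (x + y) - u y \<le> u x"
        proof (rule ge)
          fix p assume p: "p \<in> C"
          have "u (x + y) - p x \<le> u y"
          proof (rule ge)
            fix r assume r: "r \<in> C"
            have "u (x + y) \<le> p x + r y"
              using total[OF p r]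
            proof
              assume "\<forall>x. r x \<le> p x"
              then show ?thesis
                using le[OF r, of "x + y"] sublinear_add[OF sub[OF r], of x y] by (smt (verit))
            next
              assume "\<forall>x. p x \<le> r x"
              then show ?thesis
                using le[OF p, of "x + y"] sublinear_add[OF sub[OF p], of x y] by (smt (verit))
            qed
            then show "u (x + y) - p x \<le> r y" by simp
          qed
          then show "u (x + y) - u y \<le> p x" by simp
        qed
        then show "u (x + y) \<le> u x + u y" by simp
      next
        fix x and c :: real assume c: "c \<ge> 0"
        obtain p where p: "p \<in> C" using False by blast
        show "u (c *\<^sub>R x) \<le> c * u x"
        proof (cases "c = 0")
          case True
          then show ?thesis using le[OF p, of 0] sublinear_0[OF sub[OF p]] by simp
        next
          case False
          have "u (c *\<^sub>R x) / c \<le> u x"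
          proof (rule ge)
            fix p assume p: "p \<in> C"
            show "u (c *\<^sub>R x) / c \<le> p x"
              using le[OF p, of "c *\<^sub>R x"] c False by (simp add: sublinear_scale[OF sub[OF p] c] field_simps)
          qed
          then show ?thesis using c False by (simp add: field_simps)
        qed
      qed
      moreover have "u x \<le> p0 x" for x
        using False le lep0 order_trans by blast
      ultimately show ?thesis using le unfolding A_def by blast
    qed
  qed
  then obtain m where m: "m \<in> A" "\<forall>a\<in>A. (\<forall>x. a x \<le> m x) \<longrightarrow> a = m" by blast
  have "p' = m" if "sublinear p'" "\<forall>x. p' x \<le> m x" for p'
  proof -
    have "m x \<le> p0 x" for x using m(1) unfolding A_def by simp
    then have "p' x \<le> p0 x" for x using that(2) order_trans by blast
    then have "p' \<in> A" using that(1) unfolding A_def by simp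
    then show ?thesis using that m(2) by simp
  qed
  then show ?thesis using m(1) unfolding A_def by blast
qed

text \<open>Hahn-Banach: a minimal sublinear functional is linear, since otherwise it could be
  decreased in the direction of some \<open>- y\<close>.\<close>

lemma linear_below_sublinear:
  assumes "sublinear p0"
  shows "\<exists>f. linear f \<and> (\<forall>x. f x \<le> p0 x)"
proof -
  obtain p where p: "sublinear p" "\<forall>x. p x \<le> p0 x"
    and min: "\<And>p'. sublinear p' \<Longrightarrow> \<forall>x. p' x \<le> p x \<Longrightarrow> p' = p"
    using exists_minimal_sublinear[OF assms] by blast
  have "p (- y) \<le> - p y" for y
    using sublinear_decrease[OF p(1), of y] min by blast
  then have neg: "p (- y) = - p y" for y
    using sublinear_minus[OF p(1), of y] by (smt (verit))
  have "linear p"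
  proof (rule linearI)
    fix x y
    show "p (x + y) = p x + p y"
      using sublinear_add[OF p(1), of x y] sublinear_add[OF p(1), of "x + y" "- y"] neg[of y] by simp
  next
    fix c x
    show "p (c *\<^sub>R x) = c *\<^sub>R p x"
    proof (cases "c \<ge> 0")
      case True
      then show ?thesis using sublinear_scale[OF p(1)] by simp
    next
      case False
      then show ?thesis
        using sublinear_scale[OF p(1), of "- c" x] neg[of "c *\<^sub>R x"] by simp
    qed
  qed
  then show ?thesis using p by blast
qed

text \<open>Decreasing the norm in the direction of w builds the value at w into the bound: p(- w)
  \<le> - norm w forces f w \<ge> norm w for every linear f below p.\<close>

lemma exists_norming_functional:
  fixes w :: "'a::real_normed_vector"
  shows "\<exists>f. linear f \<and> (\<forall>x. \<bar>f x\<bar> \<le> norm x) \<and> f w = norm w"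
proof -
  have "sublinear (norm :: 'a \<Rightarrow> real)"
    unfolding sublinear_def by (auto intro: norm_triangle_ineq)
  from sublinear_decrease[OF this, of w] obtain p
    where p: "sublinear p" "\<forall>x. p x \<le> norm x" "p (- w) \<le> - norm w" by blast
  obtain f where f: "linear f" "\<forall>x. f x \<le> p x"
    using linear_below_sublinear[OF p(1)] by blast
  have le: "f x \<le> norm x" for x using f p order_trans by blast
  have "\<bar>f x\<bar> \<le> norm x" for x
    using le[of x] le[of "- x"] linear_neg[OF f(1), of x] by simp
  moreover have "f w = norm w"
    using f(2) p(3) le[of w] linear_neg[OF f(1), of w] by (smt (verit))
  ultimately show ?thesis using f(1) by blast
qed

text \<open>A new functional that is nonzero somewhere on the joint kernel so far contributes one
  vector z of that kernel, a multiple of which corrects the value of f n without disturbing the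
  earlier functionals.\<close>

lemma finite_codimension_joint_kernel:
  fixes f :: "nat \<Rightarrow> 'a::real_vector \<Rightarrow> real"
  assumes "\<And>i. i < n \<Longrightarrow> linear (f i)"
  shows "\<exists>B. finite B \<and> (\<forall>x. \<exists>y\<in>span B. \<forall>i<n. f i (x - y) = 0)"
  using assms
proof (induction n)
  case 0
  then show ?case by (intro exI[of _ "{}"]) auto
next
  case (Suc n)
  then obtain B where B: "finite B" "\<forall>x. \<exists>y\<in>span B. \<forall>i<n. f i (x - y) = 0" by auto
  show ?case
  proof (cases "\<forall>z. (\<forall>i<n. f i z = 0) \<longrightarrow> f n z = 0")
    case True
    then show ?thesis using B by (intro exI[of _ B]) (metis less_Suc_eq)
  next
    case False
    then obtain z where z: "\<forall>i<n. f i z = 0" "f n z \<noteq> 0" by blast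
    have "\<exists>y\<in>span (insert z B). \<forall>i<Suc n. f i (x - y) = 0" for x
    proof -
      obtain y where y: "y \<in> span B" "\<forall>i<n. f i (x - y) = 0" using B by blast
      define c where "c = f n (x - y) / f n z"
      have "y + c *\<^sub>R z \<in> span (insert z B)"
        using y(1) by (intro span_add span_scale) (auto intro: span_base span_mono[THEN subsetD, of B])
      moreover have "f i (x - (y + c *\<^sub>R z)) = 0" if "i < Suc n" for i
      proof -
        have "f i (x - (y + c *\<^sub>R z)) = f i (x - y) - c * f i z"
          using linear_diff[OF Suc(2)[OF that], of "x - y" "c *\<^sub>R z"] linear_scale[OF Suc(2)[OF that]]
          by (simp add: diff_diff_eq)
        then show ?thesis using that y(2) z unfolding c_def by (cases "i = n") auto
      qed
      ultimately show ?thesis by blast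
    qed
    then show ?thesis using B(1) by (intro exI[of _ "insert z B"]) auto
  qed
qed

text \<open>In infinite dimension the joint kernel of the earlier functionals is nonzero, since
  finitely many vectors complement it. Take u n as a unit vector in it and f n as a norming
  functional of u n. Then f i sees u i but none of the later vectors, which is how tubes are told
  apart.\<close>

lemma exists_triangular_system:
  assumes inf: "\<not> (\<exists>B. finite B \<and> span B = (UNIV :: 'a::real_normed_vector set))"
  shows "\<exists>(u :: nat \<Rightarrow> 'a) f. \<forall>n. norm (u n) = 1 \<and> linear (f n) \<and> (\<forall>x. \<bar>f n x\<bar> \<le> norm x) \<and>
           f n (u n) = (1::real) \<and> (\<forall>i<n. f i (u n) = 0)"
proof -
  let ?P = "\<lambda>(s :: nat \<Rightarrow> 'a \<times> ('a \<Rightarrow> real)) n r. norm (fst r) = 1 \<and> linear (snd r) \<and>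
    (\<forall>x. \<bar>snd r x\<bar> \<le> norm x) \<and> snd r (fst r) = 1 \<and> (\<forall>i<n. snd (s i) (fst r) = 0)"
  have "\<exists>s. \<forall>n. ?P s n (s n)"
  proof (rule dependent_wellorder_choice)
    fix r and s t :: "nat \<Rightarrow> 'a \<times> ('a \<Rightarrow> real)" and n
    assume "\<And>y. y < n \<Longrightarrow> s y = t y"
    then show "?P s n r = ?P t n r" by auto
  next
    fix n and s :: "nat \<Rightarrow> 'a \<times> ('a \<Rightarrow> real)"
    assume IH: "\<And>m. m < n \<Longrightarrow> ?P s m (s m)"
    have lin: "linear (snd (s i))" if "i < n" for i using IH that by blast
    obtain B where B: "finite B" "\<forall>x. \<exists>y\<in>span B. \<forall>i<n. snd (s i) (x - y) = 0"
      using finite_codimension_joint_kernel[of n "\<lambda>i. snd (s i)"] lin by blast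
    obtain x where "x \<notin> span B" using inf B(1) by blast
    moreover obtain y where y: "y \<in> span B" "\<forall>i<n. snd (s i) (x - y) = 0" using B(2) by blast
    ultimately have ne: "x - y \<noteq> 0" by auto
    define u where "u = sgn (x - y)"
    have u: "norm u = 1" unfolding u_def using ne by (simp add: norm_sgn)
    have "snd (s i) u = 0" if "i < n" for i
      unfolding u_def sgn_div_norm using linear_scale[OF lin[OF that]] y(2) that by simp
    moreover obtain f where "linear f" "\<forall>x. \<bar>f x\<bar> \<le> norm x" "f u = norm u"
      using exists_norming_functional by blast
    ultimately show "\<exists>r. ?P s n r" using u by (intro exI[of _ "(u, f)"]) auto
  qed
  then obtain s where "\<forall>n. ?P s n (s n)" by blast
  then show ?thesis
    by (intro exI[of _ "\<lambda>n. fst (s n)"] exI[of _ "\<lambda>n. snd (s n)"]) auto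
qed

section \<open>Bounded starlike bodies\<close>

text \<open>Otherwise the ray through x meets the boundary twice: at some s1 \<ge> 1, because it
  leaves the bounded set A after x, and at some s2 \<le> t, where the segment from 0 to t x leaves
  the interior.\<close>

lemma starlike_body_scale_interior:
  assumes star: "starlike_body A" and "bounded A" and x: "x \<in> A" and t: "0 \<le> t" "t < 1"
  shows "t *\<^sub>R x \<in> interior A"
proof (cases "x = 0")
  case True
  then show ?thesis using star unfolding starlike_body_def by simp
next
  case False
  show ?thesis
  proof (rule ccontr)
    assume tx: "t *\<^sub>R x \<notin> interior A"
    obtain M where M: "\<forall>y\<in>A. norm y \<le> M" using assms(2) unfolding bounded_iff by blast
    define r where "r = max 1 ((\<bar>M\<bar> + 1) / norm x)"
    have "norm (r *\<^sub>R x) \<ge> \<bar>M\<bar> + 1"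
      using False unfolding r_def by (auto simp: max_def field_simps)
    then have r: "r *\<^sub>R x \<notin> A" "r \<ge> 1" using M unfolding r_def by force+
    have con: "connected ((\<lambda>s. s *\<^sub>R x) ` {a..b})" for a b :: real
      by (intro connected_continuous_image continuous_intros) simp
    have "(\<lambda>s. s *\<^sub>R x) ` {1..r} \<inter> frontier A \<noteq> {}"
    proof (rule connected_Int_frontier[OF con])
      have "1 *\<^sub>R x \<in> (\<lambda>s. s *\<^sub>R x) ` {1..r}" using r(2) by (intro imageI) auto
      then show "(\<lambda>s. s *\<^sub>R x) ` {1..r} \<inter> A \<noteq> {}" using x by auto
      have "r *\<^sub>R x \<in> (\<lambda>s. s *\<^sub>R x) ` {1..r}" using r(2) by (intro imageI) auto
      then show "(\<lambda>s. s *\<^sub>R x) ` {1..r} - A \<noteq> {}" using r(1) by auto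
    qed
    then obtain s1 where s1: "s1 \<ge> 1" "s1 *\<^sub>R x \<in> frontier A" by auto
    \<comment> \<open>The crossing is taken for \<open>interior A\<close>, as t x may still lie in
      A; the frontier of the interior is part of the frontier of A.\<close>
    have "(\<lambda>s. s *\<^sub>R x) ` {0..t} \<inter> frontier (interior A) \<noteq> {}"
    proof (rule connected_Int_frontier[OF con])
      have "0 *\<^sub>R x \<in> (\<lambda>s. s *\<^sub>R x) ` {0..t}" using t(1) by (intro imageI) auto
      then show "(\<lambda>s. s *\<^sub>R x) ` {0..t} \<inter> interior A \<noteq> {}"
        using star unfolding starlike_body_def by auto
      have "t *\<^sub>R x \<in> (\<lambda>s. s *\<^sub>R x) ` {0..t}" using t(1) by (intro imageI) auto
      then show "(\<lambda>s. s *\<^sub>R x) ` {0..t} - interior A \<noteq> {}" using tx by auto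
    qed
    then obtain s2 where "s2 \<in> {0..t}" "s2 *\<^sub>R x \<in> frontier (interior A)" by blast
    then have s2: "0 \<le> s2" "s2 \<le> t" "s2 *\<^sub>R x \<in> frontier A"
      using frontier_interior_subset[of A] by auto
    have "s1 = s2"
      using star False s1 s2 unfolding starlike_body_def by (meson order_trans zero_le_one)
    then show False using s1 s2 t by simp
  qed
qed

text \<open>The other properties of the functional are derived from this one. If x / t is in A for
  some t < s, then x / s is its multiple by t / s < 1 and hence interior; conversely the interior is
  open, so x / s can be moved outwards a little.\<close>

lemma minkowski_fun_less_iff:
  assumes star: "starlike_body A" and bdd: "bounded A" and s: "s > 0"
  shows "minkowski_fun A x < s \<longleftrightarrow> x /\<^sub>R s \<in> interior A"
proof
  let ?S = "{t. t > 0 \<and> inverse t *\<^sub>R x \<in> A}"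
  assume "minkowski_fun A x < s"
  then have lt: "Inf ?S < s" unfolding minkowski_fun_def .
  have "?S \<noteq> {}"
  proof -
    have "0 \<in> interior A" using star unfolding starlike_body_def by simp
    then obtain e where e: "e > 0" "ball 0 e \<subseteq> A"
      unfolding mem_interior by (elim exE conjE)
    have "norm (inverse ((norm x + 1) / e) *\<^sub>R x) < e"
    proof -
      have "norm x + 1 > 0" using norm_ge_zero[of x] by linarith
      then show ?thesis using e(1) by (simp add: field_simps)
    qed
    then have "inverse ((norm x + 1) / e) *\<^sub>R x \<in> A" using e(2) by (auto simp: dist_norm)
    moreover have "(norm x + 1) / e > 0" using e(1) by (simp add: add_nonneg_pos)
    ultimately have "(norm x + 1) / e \<in> ?S" by simp
    then show ?thesis by blast
  qed
  from cInf_lessD[OF this lt] obtain t where t: "t > 0" "inverse t *\<^sub>R x \<in> A" "t < s"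
    by auto
  have "(t / s) *\<^sub>R (inverse t *\<^sub>R x) \<in> interior A"
    using t s by (intro starlike_body_scale_interior[OF star bdd]) auto
  then show "x /\<^sub>R s \<in> interior A" using t(1) by (simp add: field_simps)
next
  assume "x /\<^sub>R s \<in> interior A"
  moreover have "((\<lambda>t. x /\<^sub>R t) \<longlongrightarrow> x /\<^sub>R s) (at_left s)"
    using s by (intro tendsto_intros) auto
  ultimately have "\<forall>\<^sub>F t in at_left s. x /\<^sub>R t \<in> interior A"
    by (intro topological_tendstoD) auto
  moreover have "\<forall>\<^sub>F t in at_left s. t \<in> {0<..<s}"
    using s by (rule eventually_at_left_real)
  ultimately have "\<forall>\<^sub>F t in at_left s. t \<in> {0<..<s} \<and> x /\<^sub>R t \<in> interior A"
    by eventually_elim simp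
  then obtain t where t: "0 < t" "t < s" "x /\<^sub>R t \<in> interior A"
    using eventually_happens[of _ "at_left s"] by (auto simp: trivial_limit_at_left_real)
  have "minkowski_fun A x \<le> t"
    unfolding minkowski_fun_def using t interior_subset[of A]
    by (intro cInf_lower bdd_belowI[of _ 0]) auto
  then show "minkowski_fun A x < s" using t(2) by simp
qed

context
  fixes A :: "'a::real_normed_vector set"
  assumes star: "starlike_body A" and bdd: "bounded A"
begin

text \<open>Only the unspecified infimum of the empty set could be negative; but a value below 1
  puts x into A, so that 1 belongs to the set.\<close>

lemma minkowski_fun_nonneg: "minkowski_fun A x \<ge> 0"
proof (rule ccontr)
  assume "\<not> ?thesis"
  then have neg: "minkowski_fun A x < 0" by simp
  let ?S = "{t. t > 0 \<and> inverse t *\<^sub>R x \<in> A}"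
  have "x /\<^sub>R 1 \<in> interior A"
    using minkowski_fun_less_iff[OF star bdd, of 1 x] neg by simp
  then have "1 \<in> ?S" using interior_subset[of A] by auto
  then have "?S \<noteq> {}" by blast
  then have "0 \<le> Inf ?S" by (intro cInf_greatest) auto
  then show False using neg unfolding minkowski_fun_def by simp
qed

text \<open>Two nonnegative reals with the same positive strict upper bounds are equal, so comparing
  sublevel sets is enough.\<close>

lemma minkowski_fun_scaleR:
  assumes c: "c > 0"
  shows "minkowski_fun A (c *\<^sub>R x) = c * minkowski_fun A x"
proof -
  have iff: "minkowski_fun A (c *\<^sub>R x) < s \<longleftrightarrow> c * minkowski_fun A x < s" if s: "s > 0" for s
  proof -
    have "minkowski_fun A (c *\<^sub>R x) < s \<longleftrightarrow> (c *\<^sub>R x) /\<^sub>R s \<in> interior A"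
      by (rule minkowski_fun_less_iff[OF star bdd s])
    also have "(c *\<^sub>R x) /\<^sub>R s = x /\<^sub>R (s / c)" by (simp add: field_simps)
    also have "\<dots> \<in> interior A \<longleftrightarrow> minkowski_fun A x < s / c"
      using s c by (subst minkowski_fun_less_iff[OF star bdd]) auto
    finally show ?thesis using c by (simp add: field_simps)
  qed
  have "minkowski_fun A (c *\<^sub>R x) \<ge> 0" "c * minkowski_fun A x \<ge> 0"
    using minkowski_fun_nonneg c by simp_all
  then show ?thesis
    using iff by (meson antisym_conv3 le_less_trans less_irrefl)
qed

lemma minkowski_fun_less_one_iff: "minkowski_fun A x < 1 \<longleftrightarrow> x \<in> interior A"
  using minkowski_fun_less_iff[OF star bdd, of 1 x] by simp

lemma subset_closure_interior: "A \<subseteq> closure (interior A)"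
proof
  fix x assume x: "x \<in> A"
  have "((\<lambda>t. t *\<^sub>R x) \<longlongrightarrow> 1 *\<^sub>R x) (at_left 1)" by (intro tendsto_intros)
  moreover have "\<forall>\<^sub>F t in at_left 1. t \<in> {0<..<1::real}" by (rule eventually_at_left_real) simp
  then have "\<forall>\<^sub>F t in at_left 1. t *\<^sub>R x \<in> closure (interior A)"
    by eventually_elim (use starlike_body_scale_interior[OF star bdd x] closure_subset in force)
  ultimately have "1 *\<^sub>R x \<in> closure (interior A)"
    by (intro Lim_in_closed_set[of _ "\<lambda>t. t *\<^sub>R x" "at_left (1::real)"]) (auto simp: trivial_limit_at_left_real)
  then show "x \<in> closure (interior A)" by simp
qed

text \<open>A ball around 0 inside A gives this bound and the boundedness of A gives the next one.
  Together they make the functional comparable with the norm, so that the two kinds of balls can be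
  exchanged at the cost of constants.\<close>

lemma minkowski_fun_upper_bound: "\<exists>R>0. \<forall>x. minkowski_fun A x \<le> norm x / R"
proof -
  obtain R where R: "R > 0" "ball 0 R \<subseteq> interior A"
  proof -
    have "0 \<in> interior A" using star unfolding starlike_body_def by simp
    then show ?thesis using that open_interior[of A] unfolding open_contains_ball by blast
  qed
  have "minkowski_fun A x \<le> norm x / R" for x
  proof (rule dense_ge)
    fix s assume s: "norm x / R < s"
    then have s0: "s > 0" using R(1) by (meson divide_nonneg_pos le_less_trans norm_ge_zero)
    have "norm (x /\<^sub>R s) < R" using s s0 R(1) by (simp add: field_simps)
    then have "x /\<^sub>R s \<in> interior A" using R(2) by (auto simp: dist_norm)
    then show "minkowski_fun A x \<le> s" using minkowski_fun_less_iff[OF star bdd s0, of x] by simp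
  qed
  then show ?thesis using R(1) by blast
qed

lemma minkowski_fun_lower_bound: "\<exists>D>0. \<forall>x. norm x \<le> D * minkowski_fun A x"
proof -
  obtain D where D: "D > 0" "\<And>y. y \<in> A \<Longrightarrow> norm y \<le> D" using bdd unfolding bounded_pos by blast
  have "norm x \<le> D * minkowski_fun A x" for x
  proof -
    have "norm x / D \<le> minkowski_fun A x"
    proof (rule dense_ge)
      fix s assume s: "minkowski_fun A x < s"
      then have s0: "s > 0" using minkowski_fun_nonneg[of x] by linarith
      then have "x /\<^sub>R s \<in> A" using minkowski_fun_less_iff[OF star bdd s0] s interior_subset by blast
      from D(2)[OF this] show "norm x / D \<le> s" using s0 D(1) by (simp add: field_simps)
    qed
    then show ?thesis using D(1) by (simp add: field_simps)
  qed
  then show ?thesis using D(1) by blast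
qed

end

section \<open>Pushing the critical set away\<close>

lemma equi_Ck_restrict: "equi_Ck k S U \<Longrightarrow> V \<subseteq> U \<Longrightarrow> equi_Ck k S V"
proof (induction k arbitrary: S)
  case (Suc k)
  then have "equi_Ck k {\<lambda>x. frechet_derivative f (at x) v |f v. f \<in> S \<and> norm v \<le> 1} V"
    by (intro Suc(1)) auto
  then show ?case using Suc by auto
qed auto

lemma equi_Ck_differentiable:
  "equi_Ck k {f} UNIV \<Longrightarrow> k > 0 \<Longrightarrow> (f has_derivative frechet_derivative f (at x)) (at x)"
  using equi_Ck_has_derivative[of "k - 1" "{f}" UNIV f x] by simp

text \<open>The derivative of the inner map is a rank-one perturbation of the identity that sends w
  to (1 - \<phi>' w) w. Hence F' w = 0, and then F' h = F' (h - (\<phi>' h) w) = 0.\<close>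

lemma critical_point_push:
  assumes F: "(F has_derivative F') (at (x - \<phi> x *\<^sub>R w))" and \<phi>: "(\<phi> has_derivative \<phi>') (at x)"
    and "\<phi>' w \<noteq> 1" and G: "((\<lambda>x. F (x - \<phi> x *\<^sub>R w)) has_derivative (\<lambda>h. 0::real)) (at x)"
  shows "F' = (\<lambda>h. 0)"
proof -
  have "((\<lambda>x. x - \<phi> x *\<^sub>R w) has_derivative (\<lambda>h. h - \<phi>' h *\<^sub>R w)) (at x)"
    by (auto intro!: derivative_eq_intros \<phi>)
  from has_derivative_compose[OF this F]
  have "(\<lambda>h. F' (h - \<phi>' h *\<^sub>R w)) = (\<lambda>h. 0)"
    using has_derivative_unique G by blast
  then have *: "F' (h - \<phi>' h *\<^sub>R w) = 0" for h by metis
  have lin: "linear F'" using F has_derivative_linear by blast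
  have "(1 - \<phi>' w) * F' w = F' (w - \<phi>' w *\<^sub>R w)"
    by (simp add: linear_diff[OF lin] linear_scale[OF lin] algebra_simps)
  then have "F' w = 0" using *[of w] assms(3) by simp
  then have "F' h = 0" for h
    using *[of h] by (simp add: linear_diff[OF lin] linear_scale[OF lin])
  then show ?thesis by auto
qed

text \<open>The maps \<open>x \<mapsto> x - \<phi> n x *\<^sub>R w n\<close> carry \<open>C (Suc n)\<close> to \<open>C n\<close>, so that composing with them moves the
  critical set from \<open>C n\<close> to \<open>C (Suc n)\<close>; by local finiteness of their supports
  nothing critical is left in the limit.\<close>

lemma push_off_critical_set:
  fixes F0 :: "'a::real_normed_vector \<Rightarrow> real" and w :: "nat \<Rightarrow> 'a"
  assumes K: "k0 \<in> K" "k0 > 0" and \<rho>: "\<rho> > 0"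
    and F0: "\<And>k. k \<in> K \<Longrightarrow> equi_Ck k {F0} UNIV"
    and \<phi>: "\<And>k n. k \<in> K \<Longrightarrow> equi_Ck k {\<phi> n} UNIV"
    and locfin: "\<And>z. \<exists>N. \<forall>n\<ge>N. \<forall>x\<in>ball z \<rho>. \<phi> n x = 0"
    and slope: "\<And>n x. frechet_derivative (\<phi> n) (at x) (w n) \<noteq> 1"
    and V: "\<And>n x. \<phi> n x \<noteq> 0 \<Longrightarrow> x \<in> V" "\<And>n x. \<phi> n x \<noteq> 0 \<Longrightarrow> x - \<phi> n x *\<^sub>R w n \<in> V"
    and crit0: "\<And>x. x \<in> V \<Longrightarrow> frechet_derivative F0 (at x) = (\<lambda>h. 0) \<Longrightarrow> x \<in> C 0"
    and step: "\<And>n x. x - \<phi> n x *\<^sub>R w n \<in> C n \<Longrightarrow> x \<in> C (Suc n)"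
    and tube: "\<And>n x. x \<in> C (Suc n) \<Longrightarrow> \<phi> n x \<noteq> 0"
  shows "\<exists>F. (\<forall>k\<in>K. equi_Ck k {F} UNIV) \<and> (\<forall>x. x \<notin> V \<longrightarrow> F x = F0 x) \<and>
    (\<forall>x\<in>V. frechet_derivative F (at x) \<noteq> (\<lambda>h. 0))"
proof -
  \<comment> \<open>Each new map is inserted innermost, so \<open>G (Suc n)\<close> and
    \<open>G n\<close> agree wherever \<phi> n vanishes.\<close>
  define G where "G = rec_nat F0 (\<lambda>n g x. g (x - \<phi> n x *\<^sub>R w n))"
  have G0: "G 0 = F0" and GS: "G (Suc n) = (\<lambda>x. G n (x - \<phi> n x *\<^sub>R w n))" for n
    unfolding G_def by simp_all
  have smooth: "equi_Ck k {G n} UNIV" if "k \<in> K" for k n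
  proof (induction n)
    case 0
    show ?case unfolding G0 using F0 that .
  next
    case (Suc n)
    have "equi_Ck k ((\<lambda>f x. f (0 + x + \<phi> n x *\<^sub>R (- w n))) ` {G n}) UNIV"
      by (rule equi_Ck_compose[OF open_UNIV open_UNIV bounded_linear_ident _ \<phi>[OF that] Suc]) simp
    then show ?case unfolding GS by simp
  qed
  have dG: "(G n has_derivative frechet_derivative (G n) (at x)) (at x)" for n x
    using equi_Ck_differentiable[OF smooth[OF K(1)] K(2)] .
  have crit: "x \<in> C n" if "x \<in> V" "frechet_derivative (G n) (at x) = (\<lambda>h. 0)" for n x
    using that
  proof (induction n arbitrary: x)
    case 0
    then show ?case using crit0 unfolding G0 by blast
  next
    case (Suc n)
    let ?y = "x - \<phi> n x *\<^sub>R w n"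
    have "((\<lambda>x. G n (x - \<phi> n x *\<^sub>R w n)) has_derivative (\<lambda>h. 0)) (at x)"
      using dG[of "Suc n" x] unfolding Suc(3) unfolding GS .
    from critical_point_push[OF dG equi_Ck_differentiable[OF \<phi>[OF K(1)] K(2)] slope this]
    have "frechet_derivative (G n) (at ?y) = (\<lambda>h. 0)" .
    moreover have "?y \<in> V" using Suc(2) V(2)[of n x] by (cases "\<phi> n x = 0") auto
    ultimately show ?case using Suc(1) step by blast
  qed
  have outside: "G n x = F0 x" if "x \<notin> V" for n x
  proof (induction n)
    case (Suc n)
    have "\<phi> n x = 0" using V(1) that by blast
    then show ?case unfolding GS using Suc by simp
  qed (simp add: G0)
  obtain N where N: "\<And>z n x. n \<ge> N z \<Longrightarrow> x \<in> ball z \<rho> \<Longrightarrow> \<phi> n x = 0"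
    using locfin by metis
  have stable: "G n x = G (N z) x" if "n \<ge> N z" "x \<in> ball z \<rho>" for n x z
    using that(1)
  proof (induction n rule: dec_induct)
    case (step n)
    then show ?case unfolding GS using N[OF step(1) that(2)] by simp
  qed simp
  define F where "F x = G (N x) x" for x
  have F: "F x = G n x" if "x \<in> ball z \<rho>" "n \<ge> N z" for x z n
  proof -
    have "F x = G (max n (N x)) x"
      unfolding F_def using \<rho> by (intro stable[symmetric]) auto
    also have "\<dots> = G (N z) x" using that by (intro stable) auto
    also have "\<dots> = G n x" using that by (intro stable[symmetric]) auto
    finally show ?thesis .
  qed
  show ?thesis
  proof (intro exI[of _ F] conjI ballI allI impI)
    fix k assume k: "k \<in> K"
    have "equi_Ck k {F} (\<Union>(range (\<lambda>z. ball z \<rho>)))"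
    proof (rule equi_Ck_Union)
      fix U :: "'a set" assume "U \<in> range (\<lambda>z. ball z \<rho>)"
      then obtain z where U: "U = ball z \<rho>" by blast
      show "equi_Ck k {F} U"
        unfolding U
        by (rule equi_Ck_mono[OF open_ball equi_Ck_restrict[OF smooth[OF k, of "N z"]]]) (use F in auto)
    qed
    also have "\<Union>(range (\<lambda>z. ball z \<rho>)) = UNIV" using \<rho> by auto
    finally show "equi_Ck k {F} UNIV" .
  next
    fix x assume "x \<notin> V"
    then show "F x = F0 x" unfolding F_def by (rule outside)
  next
    fix x assume x: "x \<in> V"
    \<comment> \<open>The successor matters: \<open>tube\<close> speaks of \<open>C (Suc n)\<close>,
      and the contradiction is with \<phi> (N x), which vanishes at x.\<close>
    let ?n = "Suc (N x)"
    have "(F has_derivative frechet_derivative (G ?n) (at x)) (at x)"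
      by (rule has_derivative_transform_within_open[OF dG open_ball[of x \<rho>]])
        (use \<rho> F[of _ x ?n] in auto)
    then have eq: "frechet_derivative F (at x) = frechet_derivative (G ?n) (at x)"
      using frechet_derivative_at by metis
    show "frechet_derivative F (at x) \<noteq> (\<lambda>h. 0)"
    proof
      assume "frechet_derivative F (at x) = (\<lambda>h. 0)"
      then have "x \<in> C ?n" using crit x eq by simp
      then have "\<phi> (N x) x \<noteq> 0" by (rule tube)
      then show False using N[of x "N x" x] \<rho> by simp
    qed
  qed
qed

text \<open>Near 0, where the functional need not be differentiable, the composite is constant 1:
  this holds on the ball of radius r * R. That ball and the complement of 0 cover the space.\<close>

lemma equi_Ck_radial:
  fixes A :: "'a::real_normed_vector set"
  assumes star: "starlike_body A" and bdd: "bounded A"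
    and q: "equi_Ck k {minkowski_fun A} (UNIV - {0})"
    and b: "equi_Ck k {b} UNIV" "\<And>t. t \<le> r \<Longrightarrow> b t = 1" and r: "r > 0"
  shows "equi_Ck k {\<lambda>x. b (minkowski_fun A x)} UNIV"
proof -
  obtain R where R: "R > 0" "\<And>x. minkowski_fun A x \<le> norm x / R"
    using minkowski_fun_upper_bound[OF star bdd] by blast
  have "equi_Ck k {\<lambda>x. b (minkowski_fun A x)} (\<Union>{UNIV - {0}, ball 0 (r * R)})"
  proof (rule equi_Ck_Union)
    fix U assume "U \<in> {UNIV - {0::'a}, ball 0 (r * R)}"
    then consider "U = UNIV - {0}" | "U = ball 0 (r * R)" by blast
    then show "equi_Ck k {\<lambda>x. b (minkowski_fun A x)} U"
    proof cases
      case 1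
      show ?thesis unfolding 1 by (rule equi_Ck_compose_fun[OF _ q b(1)]) (simp add: open_delete)
    next
      case 2
      have "b (minkowski_fun A x) = 1" if "x \<in> ball 0 (r * R)" for x
      proof (rule b(2))
        have "norm x / R < r" using that R(1) by (simp add: field_simps)
        then show "minkowski_fun A x \<le> r" using R(2)[of x] by linarith
      qed
      then show ?thesis
        unfolding 2 by (intro equi_Ck_mono[OF open_ball equi_Ck_const_fun[OF open_ball, of k 1]]) auto
    qed
  qed
  also have "\<Union>{UNIV - {0}, ball 0 (r * R)} = (UNIV :: 'a set)" using r R(1) by auto
  finally show ?thesis .
qed

text \<open>Reads off derivatives along lines on which the function reduces to one real variable:
  along w n for \<phi> n, and along the ray through x for l(q).\<close>

lemma directional_derivative:
  assumes "(f has_derivative f') (at x)" "((\<lambda>t. f (x + t *\<^sub>R w)) has_real_derivative d) (at 0)"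
  shows "f' w = d"
proof -
  have "((\<lambda>t::real. x + t *\<^sub>R w) has_derivative (\<lambda>t. t *\<^sub>R w)) (at 0)"
    by (auto intro!: derivative_eq_intros)
  then have "((\<lambda>t. f (x + t *\<^sub>R w)) has_derivative (\<lambda>t. f' (t *\<^sub>R w))) (at 0)"
    by (rule has_derivative_compose) (use assms(1) in simp)
  then have "(\<lambda>t. f' (t *\<^sub>R w)) = (*) d"
    using assms(2) unfolding has_field_derivative_def using has_derivative_unique by blast
  from fun_cong[OF this, of 1] show ?thesis by simp
qed

section \<open>Tubes inside the body and the resulting bump function\<close>

theorem theorem3p1:
  fixes A :: "'a::banach set" and p :: enat
  assumes inf_dim: "\<not> (\<exists>B. finite B \<and> span B = (UNIV :: 'a set))"
    and p: "p \<ge> 1"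
    and star: "starlike_body A"
    and bdd: "bounded A"
    and smooth: "smooth_body p A"
  shows "\<exists>g :: 'a \<Rightarrow> real. Cp_on p g UNIV \<and> bump g \<and> supp g = A \<and>
           (\<forall>x\<in>interior A. frechet_derivative g (at x) \<noteq> (\<lambda>h. 0))"
proof -
  define q where "q = minkowski_fun A"
  define K where "K = {k. enat k \<le> p}"
  obtain R where R: "R > 0" "\<And>x. q x \<le> norm x / R"
    unfolding q_def using minkowski_fun_upper_bound[OF star bdd] by blast
  obtain D where D: "D > 0" "\<And>x. norm x \<le> D * q x"
    unfolding q_def using minkowski_fun_lower_bound[OF star bdd] by blast
  have q_nonneg: "q x \<ge> 0" for x unfolding q_def by (rule minkowski_fun_nonneg[OF star bdd])
  have q_scale: "q (c *\<^sub>R x) = c * q x" if "c > 0" for c x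
    unfolding q_def by (rule minkowski_fun_scaleR[OF star bdd that])
  have int: "x \<in> interior A \<longleftrightarrow> q x < 1" for x
    unfolding q_def using minkowski_fun_less_one_iff[OF star bdd] by simp
  \<comment> \<open>Boundedness reduces the characteristic cone to 0, so the smoothness of the body
    covers all x other than 0.\<close>
  have q0: "q x = 0 \<longleftrightarrow> x = 0" for x
    using D(2)[of x] R(2)[of x] q_nonneg[of x] by auto
  have qK: "equi_Ck k {q} (UNIV - {0})" if "k \<in> K" for k
  proof (rule Ck_on_imp_equi_Ck)
    show "open (UNIV - {0::'a})" by (simp add: open_delete)
    have "UNIV - {x. minkowski_fun A x = 0} = UNIV - {0}" using q0 unfolding q_def by auto
    then show "Ck_on k q (UNIV - {0})"
      using smooth that unfolding smooth_body_def Cp_on_def K_def q_def by simp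
  qed
  have K1: "1 \<in> K" "(1::nat) > 0" unfolding K_def using p by (simp_all add: one_enat_def)

  from exists_slow_cutoff obtain a a' :: "real \<Rightarrow> real" and c where
    "(\<forall>k. equi_Ck k {a} UNIV) \<and>
    (\<forall>t. (a has_real_derivative a' t) (at t)) \<and> (\<forall>t. \<bar>a' t\<bar> < 1) \<and>
    (\<forall>t. 0 \<le> t \<longrightarrow> t \<le> 2 \<longrightarrow> a t = 1) \<and> (\<forall>t. 0 \<le> a t \<and> a t \<le> 1) \<and>
    c \<ge> 0 \<and> (\<forall>t. a t \<noteq> 0 \<longrightarrow> \<bar>t\<bar> \<le> c)"
    by (elim exE)
  then have a: "\<And>k. equi_Ck k {a} UNIV" "\<And>t. (a has_real_derivative a' t) (at t)"
    "\<And>t. \<bar>a' t\<bar> < 1" "\<And>t. 0 \<le> t \<Longrightarrow> t \<le> 2 \<Longrightarrow> a t = 1" "\<And>t. 0 \<le> a t" "\<And>t. a t \<le> 1"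
    "c \<ge> 0" "\<And>t. a t \<noteq> 0 \<Longrightarrow> \<bar>t\<bar> \<le> c"
    by simp_all
  \<comment> \<open>\<tau> keeps all tubes, even after a shift by at most w n, in the ball of radius
    R; \<rho> bounds the tube radius so that four radii make \<tau> / 4; \<sigma> makes q < 2
    \<sigma> imply norm \<le> \<rho>. For r, the bound D r \<le> \<tau> keeps the coordinate of a
    critical ball along the tube in [-1, 1], and 3 D r / R \<le> \<sigma> keeps its projection, of
    at most three times the norm, where b is 1.\<close>
  define \<tau> where "\<tau> = R / (2 * c + 6)"
  define \<rho> where "\<rho> = \<tau> / 16"
  define \<sigma> where "\<sigma> = \<rho> / (2 * D)"
  define r where "r = min (1/2) (min (\<tau> / D) (R * \<sigma> / (3 * D)))"
  have \<tau>: "\<tau> > 0" "(2 * c + 6) * \<tau> = R" unfolding \<tau>_def using R(1) a(7) by simp_all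
  have \<rho>: "\<rho> > 0" unfolding \<rho>_def using \<tau> by simp
  have \<sigma>: "\<sigma> > 0" "D * (2 * \<sigma>) = \<rho>" unfolding \<sigma>_def using \<rho> D by simp_all
  have r: "r > 0" "r < 1" "D * r \<le> \<tau>" "3 * (D * r) / R \<le> \<sigma>"
  proof -
    show "r > 0" unfolding r_def using \<tau> D R \<sigma> by simp
    show "r < 1" unfolding r_def by simp
    have "r \<le> \<tau> / D" unfolding r_def by simp
    then show "D * r \<le> \<tau>" using D(1) by (simp add: field_simps)
    have "r \<le> R * \<sigma> / (3 * D)" unfolding r_def by simp
    then show "3 * (D * r) / R \<le> \<sigma>" using D(1) R(1) by (simp add: field_simps)
  qed
  from exists_smooth_cutoff[of \<sigma> "2 * \<sigma>"] \<sigma>(1) obtain b b' :: "real \<Rightarrow> real" and M where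
    "(\<forall>k. equi_Ck k {b} UNIV) \<and>
    (\<forall>t. (b has_real_derivative b' t) (at t)) \<and> (\<forall>t\<le>\<sigma>. b t = 1) \<and> (\<forall>t\<ge>2 * \<sigma>. b t = 0) \<and>
    (\<forall>t. 0 \<le> b t \<and> b t \<le> 1) \<and> (\<forall>t. \<sigma> < t \<longrightarrow> t < 2 * \<sigma> \<longrightarrow> b' t < 0) \<and>
    (\<forall>t\<ge>2 * \<sigma>. b' t = 0) \<and> (\<forall>t. \<bar>b' t\<bar> \<le> M)"
    by auto
  then have b: "\<And>k. equi_Ck k {b} UNIV" "\<And>t. t \<le> \<sigma> \<Longrightarrow> b t = 1" "\<And>t. t \<ge> 2 * \<sigma> \<Longrightarrow> b t = 0"
    "\<And>t. 0 \<le> b t" "\<And>t. b t \<le> 1"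
    by simp_all
  from exists_smooth_cutoff[OF r(2)] obtain l l' :: "real \<Rightarrow> real" and M where
    "(\<forall>k. equi_Ck k {l} UNIV) \<and>
    (\<forall>t. (l has_real_derivative l' t) (at t)) \<and> (\<forall>t\<le>r. l t = 1) \<and> (\<forall>t\<ge>1. l t = 0) \<and>
    (\<forall>t. 0 \<le> l t \<and> l t \<le> 1) \<and> (\<forall>t. r < t \<longrightarrow> t < 1 \<longrightarrow> l' t < 0) \<and>
    (\<forall>t\<ge>1. l' t = 0) \<and> (\<forall>t. \<bar>l' t\<bar> \<le> M)"
    by (elim exE)
  then have l: "\<And>k. equi_Ck k {l} UNIV" "\<And>t. (l has_real_derivative l' t) (at t)"
    "\<And>t. t \<le> r \<Longrightarrow> l t = 1" "\<And>t. t \<ge> 1 \<Longrightarrow> l t = 0" "\<And>t. r < t \<Longrightarrow> t < 1 \<Longrightarrow> l' t < 0"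
    by simp_all
  from exists_triangular_system[OF inf_dim] obtain u :: "nat \<Rightarrow> 'a" and f :: "nat \<Rightarrow> 'a \<Rightarrow> real" where
    "\<forall>n. norm (u n) = 1 \<and> linear (f n) \<and> (\<forall>x. \<bar>f n x\<bar> \<le> norm x) \<and>
           f n (u n) = 1 \<and> (\<forall>i<n. f i (u n) = 0)"
    by (elim exE)
  then have u: "\<And>n. norm (u n) = 1" and f: "\<And>n. linear (f n)" "\<And>n x. \<bar>f n x\<bar> \<le> norm x"
    "\<And>n. f n (u n) = 1" "\<And>i n. i < n \<Longrightarrow> f i (u n) = 0"
    by simp_all

  define P where "P n = \<tau> *\<^sub>R (u n - u 0)" for n
  define w where "w n = \<tau> *\<^sub>R (u (Suc n) - u n)" for n
  \<comment> \<open>The coordinate along w n. Since f n is 1 at u n and 0 at u (Suc n), f n (w n) =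
    - \<tau>, whence the sign. Then \<pi> n projects along w n, and \<phi> n multiplies a profile
    along the tube with one across it.\<close>
  define g where "g n x = f n x * (- inverse \<tau>)" for n x
  define \<pi> where "\<pi> n x = x - g n x *\<^sub>R w n" for n x
  define \<phi> where "\<phi> n x = a (g n (x - P n)) * b (q (\<pi> n (x - P n)))" for n x
  have PS: "P (Suc n) = P n + w n" for n unfolding P_def w_def by (simp add: algebra_simps)
  have normP: "norm (P n) \<le> 2 * \<tau>" for n
    unfolding P_def using norm_triangle_ineq4[of "u n" "u 0"] u \<tau>(1) by (simp add: mult.commute)
  have normw: "norm (w n) \<le> 2 * \<tau>" for n
    unfolding w_def using norm_triangle_ineq4[of "u (Suc n)" "u n"] u \<tau>(1) by (simp add: mult.commute)
  have blf: "bounded_linear (f n)" for n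
    unfolding bounded_linear_def bounded_linear_axioms_def
    using f by (auto intro!: exI[of _ 1])
  have blg: "bounded_linear (g n)" for n
    unfolding g_def by (rule bounded_linear_mult_const[OF blf])
  have bl\<pi>: "bounded_linear (\<pi> n)" for n
    unfolding \<pi>_def by (intro bounded_linear_sub bounded_linear_ident bounded_linear_scaleR_const blg)
  note ling = bounded_linear.linear[OF blg] and lin\<pi> = bounded_linear.linear[OF bl\<pi>]
  have gw: "g n (w n) = 1" for n
    unfolding g_def w_def using \<tau>(1) f(3)[of n] f(4)[of n "Suc n"]
    by (simp add: linear_scale[OF f(1)] linear_diff[OF f(1)])
  have \<pi>w: "\<pi> n (w n) = 0" for n unfolding \<pi>_def gw by simp
  have gle: "\<bar>g n x\<bar> \<le> norm x / \<tau>" for n x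
    unfolding g_def using f(2)[of n x] \<tau>(1) by (simp add: abs_mult field_simps)
  have \<pi>le: "norm (\<pi> n x) \<le> 3 * norm x" for n x
  proof -
    have "norm (\<pi> n x) \<le> norm x + \<bar>g n x\<bar> * norm (w n)"
      unfolding \<pi>_def using norm_triangle_ineq4[of x "g n x *\<^sub>R w n"] by simp
    also have "\<dots> \<le> norm x + norm x / \<tau> * (2 * \<tau>)"
      using gle normw \<tau>(1) by (intro add_left_mono mult_mono) auto
    also have "\<dots> = 3 * norm x" using \<tau>(1) by simp
    finally show ?thesis .
  qed
  \<comment> \<open>Along w n only the factor a varies, because \<pi> n annihilates w n.\<close>
  have \<phi>_line: "\<phi> n (x + h *\<^sub>R w n) = a (g n (x - P n) + h) * b (q (\<pi> n (x - P n)))" for n x h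
  proof -
    have "x + h *\<^sub>R w n - P n = (x - P n) + h *\<^sub>R w n" by simp
    then show ?thesis
      unfolding \<phi>_def by (simp only: linear_add[OF ling] linear_scale[OF ling] linear_add[OF lin\<pi>]
          linear_scale[OF lin\<pi>] gw \<pi>w) simp
  qed
  have \<phi>01: "\<bar>\<phi> n x\<bar> \<le> 1" for n x
    unfolding \<phi>_def abs_mult using a(5,6) b(4,5) by (intro mult_le_one) auto

  have tube: "\<bar>g n (x - P n)\<bar> \<le> c" "norm (\<pi> n (x - P n)) \<le> \<rho>" if "\<phi> n x \<noteq> 0" for n x
  proof -
    show "\<bar>g n (x - P n)\<bar> \<le> c" using that a(8) unfolding \<phi>_def by simp
    have "q (\<pi> n (x - P n)) < 2 * \<sigma>" using that b(3)[of "q (\<pi> n (x - P n))"] unfolding \<phi>_def by (metis mult_zero_right not_le)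
    then have "D * q (\<pi> n (x - P n)) \<le> D * (2 * \<sigma>)" using D(1) by simp
    then show "norm (\<pi> n (x - P n)) \<le> \<rho>" using D(2)[of "\<pi> n (x - P n)"] \<sigma>(2) by linarith
  qed
  \<comment> \<open>The slack 2 \<tau> leaves room for the shift by a multiple of w n.\<close>
  have tube_norm: "norm x + 2 * \<tau> < R" if "\<phi> n x \<noteq> 0" for n x
  proof -
    have "x = P n + g n (x - P n) *\<^sub>R w n + \<pi> n (x - P n)" unfolding \<pi>_def by simp
    then have "norm x \<le> norm (P n) + norm (g n (x - P n) *\<^sub>R w n) + norm (\<pi> n (x - P n))"
      by (metis norm_add_rule_thm norm_triangle_mono order_refl)
    also have "\<dots> \<le> 2 * \<tau> + c * (2 * \<tau>) + \<rho>"
      unfolding norm_scaleR using tube[OF that] normP normw a(7)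
      by (intro add_mono mult_mono) auto
    also have "\<dots> < (2 * c + 6) * \<tau> - 2 * \<tau>"
      unfolding \<rho>_def using \<tau>(1) by (simp add: algebra_simps)
    finally show ?thesis using \<tau>(2) by simp
  qed
  have small: "x \<in> interior A" if "norm x < R" for x
    unfolding int using R(2)[of x] that R(1) by (meson divide_less_eq_1_pos le_less_trans)

  \<comment> \<open>If x and y were close, their axis points would differ by z with norm below
    \<tau> / 4. Applying f n to z gives |1 - s| < 1/4; applying f (Suc n), which vanishes at u m
    since m \<ge> n + 2, then gives |s| < 1/2, a contradiction.\<close>
  have far: "norm (x - y) \<ge> 2 * \<rho>" if x: "\<phi> n x \<noteq> 0" and y: "\<phi> m y \<noteq> 0" and nm: "m \<ge> n + 2" for n m x y
  proof (rule ccontr)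
    assume "\<not> ?thesis"
    then have xy: "norm (x - y) < 2 * \<rho>" by simp
    define s where "s = g n (x - P n)"
    define t where "t = g m (y - P m)"
    define z where "z = (x - y) - \<pi> n (x - P n) + \<pi> m (y - P m)"
    have "norm z \<le> norm (x - y) + norm (\<pi> n (x - P n)) + norm (\<pi> m (y - P m))"
      unfolding z_def by (smt (verit) norm_triangle_ineq norm_triangle_ineq4)
    then have "norm z < 4 * \<rho>" using tube(2)[OF x] tube(2)[OF y] xy by linarith
    then have z: "norm z < \<tau> / 4" unfolding \<rho>_def by simp
    have "z = \<tau> *\<^sub>R ((1 - s) *\<^sub>R u n + s *\<^sub>R u (Suc n) - (1 - t) *\<^sub>R u m - t *\<^sub>R u (Suc m))"
      unfolding z_def \<pi>_def s_def[symmetric] t_def[symmetric] unfolding P_def w_def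
      by (simp add: algebra_simps)
    then have fz: "f i z = \<tau> * ((1 - s) * f i (u n) + s * f i (u (Suc n)) - (1 - t) * f i (u m) - t * f i (u (Suc m)))" for i
      by (simp add: linear_scale[OF f(1)] linear_diff[OF f(1)] linear_add[OF f(1)])
    have "f n z = \<tau> * (1 - s)" using fz[of n] f(3)[of n] f(4)[of n "Suc n"] f(4)[of n m] f(4)[of n "Suc m"] nm by simp
    then have "\<tau> * \<bar>1 - s\<bar> < \<tau> * (1/4)"
      using f(2)[of n z] z abs_mult[of \<tau> "1 - s"] \<tau>(1) by linarith
    then have s: "\<bar>1 - s\<bar> < 1/4" unfolding mult_less_cancel_left_pos[OF \<tau>(1)] .
    have "f (Suc n) z = \<tau> * ((1 - s) * f (Suc n) (u n) + s)"
      using fz[of "Suc n"] f(3)[of "Suc n"] f(4)[of "Suc n" m] f(4)[of "Suc n" "Suc m"] nm by simp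
    then have "\<tau> * \<bar>(1 - s) * f (Suc n) (u n) + s\<bar> < \<tau> * (1/4)"
      using f(2)[of "Suc n" z] z abs_mult[of \<tau> "(1 - s) * f (Suc n) (u n) + s"] \<tau>(1) by linarith
    then have "\<bar>(1 - s) * f (Suc n) (u n) + s\<bar> < 1/4" unfolding mult_less_cancel_left_pos[OF \<tau>(1)] .
    moreover have "\<bar>(1 - s) * f (Suc n) (u n)\<bar> \<le> 1/4 * 1"
      unfolding abs_mult using s f(2)[of "Suc n" "u n"] u by (intro mult_mono) auto
    ultimately show False using s by linarith
  qed

  define C where "C n = {x. q (x - P n) \<le> r}" for n
  \<comment> \<open>At P (Suc n) + z the coordinate along the tube is g n z + 1, which is why a was
    required to be 1 on [0, 2]; the part across the tube is that of z alone.\<close>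
  have one: "\<phi> n (P (Suc n) + z) = 1" if z: "q z \<le> r" for n z
  proof -
    have "norm z \<le> D * q z" by (rule D(2))
    also have "\<dots> \<le> D * r" using z D(1) by simp
    finally have nz: "norm z \<le> D * r" .
    have eq: "P (Suc n) + z = (P n + z) + 1 *\<^sub>R w n" unfolding PS by simp
    have "\<bar>g n z\<bar> \<le> 1"
      using gle[of n z] nz r(3) \<tau>(1) by (smt (verit) divide_le_eq_1_pos)
    then have 1: "a (g n z + 1) = 1" by (intro a(4)) auto
    have "q (\<pi> n z) \<le> norm (\<pi> n z) / R" by (rule R(2))
    also have "\<dots> \<le> 3 * (D * r) / R"
      using \<pi>le[of n z] nz R(1) by (intro divide_right_mono) auto
    also have "\<dots> \<le> \<sigma>" by (rule r(4))
    finally have 2: "b (q (\<pi> n z)) = 1" by (rule b(2))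
    show ?thesis unfolding eq \<phi>_line using 1 2 by simp
  qed
  have a_contr: "\<bar>a s - a t\<bar> < \<bar>s - t\<bar>" if "s \<noteq> t" for s t
  proof -
    have *: "\<bar>a s - a t\<bar> < \<bar>s - t\<bar>" if st: "s < t" for s t
    proof -
      obtain z where "a t - a s = (t - s) * a' z"
        using MVT2[OF st, of a a'] a(2) by blast
      moreover have "(t - s) * \<bar>a' z\<bar> < (t - s) * 1" using that a(3) by (intro mult_strict_left_mono) auto
      ultimately show ?thesis using that by (simp add: abs_minus_commute[of "a s"] abs_mult)
    qed
    show ?thesis using *[of s t] *[of t s] that by (cases "s < t") (auto simp: abs_minus_commute)
  qed

  have "\<exists>F. (\<forall>k\<in>K. equi_Ck k {F} UNIV) \<and> (\<forall>x. x \<notin> interior A \<longrightarrow> F x = l (q x)) \<and>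
    (\<forall>x\<in>interior A. frechet_derivative F (at x) \<noteq> (\<lambda>h. 0))"
  proof (rule push_off_critical_set[OF K1 \<rho>, where \<phi> = \<phi> and w = w and C = C])
    show F0: "equi_Ck k {\<lambda>x. l (q x)} UNIV" if "k \<in> K" for k
      using equi_Ck_radial[OF star bdd qK[OF that, unfolded q_def] l(1) l(3) r(1)] unfolding q_def by simp
    show \<phi>K: "equi_Ck k {\<phi> n} UNIV" if "k \<in> K" for k n
    proof -
      have rad: "equi_Ck k {\<lambda>x. b (q x)} UNIV"
        using equi_Ck_radial[OF star bdd qK[OF that, unfolded q_def] b(1) b(2) \<sigma>(1)] unfolding q_def by simp
      have "equi_Ck k {\<lambda>x. a (- g n (P n) + g n x) * b (q (- \<pi> n (P n) + \<pi> n x))} UNIV"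
        by (rule equi_Ck_mult_fun[OF open_UNIV equi_Ck_compose_affine[OF blg a(1)]
              equi_Ck_compose_affine[OF bl\<pi> rad]])
      moreover have "\<phi> n = (\<lambda>x. a (- g n (P n) + g n x) * b (q (- \<pi> n (P n) + \<pi> n x)))"
        unfolding \<phi>_def by (simp add: fun_eq_iff linear_diff[OF ling] linear_diff[OF lin\<pi>])
      ultimately show ?thesis by simp
    qed
    \<comment> \<open>Two points of a ball of radius \<rho> are less than 2 \<rho> apart, so by
      \<open>far\<close> a ball that meets tube n meets no tube of index n + 2 or above.\<close>
    show "\<exists>N. \<forall>n\<ge>N. \<forall>x\<in>ball z \<rho>. \<phi> n x = 0" for z
    proof (rule ccontr)
      assume neg: "\<not> ?thesis"
      then obtain n x where x: "x \<in> ball z \<rho>" "\<phi> n x \<noteq> 0" by blast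
      obtain m y where y: "m \<ge> n + 2" "y \<in> ball z \<rho>" "\<phi> m y \<noteq> 0" using neg by blast
      have "norm (x - y) < 2 * \<rho>"
        using x(1) y(2) dist_triangle2[of x y z] by (simp add: dist_norm[symmetric] dist_commute)
      then show False using far[OF x(2) y(3) y(1)] by simp
    qed
    show "frechet_derivative (\<phi> n) (at x) (w n) \<noteq> 1" for n x
    proof -
      let ?s = "g n (x - P n)" and ?B = "b (q (\<pi> n (x - P n)))"
      have "((\<lambda>t. \<phi> n (x + t *\<^sub>R w n)) has_real_derivative a' ?s * ?B) (at 0)"
      proof -
        have "((\<lambda>t. ?s + t) has_real_derivative 1) (at 0)" by (auto intro!: derivative_eq_intros)
        moreover have "(a has_real_derivative a' ?s) (at (?s + 0))" using a(2)[of ?s] by simp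
        ultimately have "((\<lambda>t. a (?s + t)) has_real_derivative a' ?s * 1) (at 0)"
          by (rule DERIV_chain2[rotated])
        then show ?thesis unfolding \<phi>_line by (auto intro!: derivative_eq_intros)
      qed
      with equi_Ck_differentiable[OF \<phi>K[OF K1(1)] K1(2)]
      have "frechet_derivative (\<phi> n) (at x) (w n) = a' ?s * ?B"
        by (rule directional_derivative)
      moreover have "\<bar>a' ?s * ?B\<bar> < 1"
      proof -
        have "\<bar>a' ?s * ?B\<bar> \<le> \<bar>a' ?s\<bar> * 1"
          unfolding abs_mult using b(4,5) by (intro mult_left_mono) auto
        then show ?thesis using a(3)[of ?s] by linarith
      qed
      ultimately show ?thesis by auto
    qed
    show "x \<in> interior A" if "\<phi> n x \<noteq> 0" for n x
      using tube_norm[OF that] \<tau>(1) by (intro small) linarith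
    show "x - \<phi> n x *\<^sub>R w n \<in> interior A" if "\<phi> n x \<noteq> 0" for n x
    proof (rule small)
      have "norm (x - \<phi> n x *\<^sub>R w n) \<le> norm x + \<bar>\<phi> n x\<bar> * norm (w n)"
        using norm_triangle_ineq4[of x "\<phi> n x *\<^sub>R w n"] by simp
      also have "\<dots> \<le> norm x + 1 * (2 * \<tau>)"
        using \<phi>01 normw by (intro add_left_mono mult_mono) auto
      finally show "norm (x - \<phi> n x *\<^sub>R w n) < R" using tube_norm[OF that] by simp
    qed
    \<comment> \<open>For r < q x < 1 the derivative of l(q) in the radial direction x is l'(q x) q
      x, which is negative.\<close>
    show "x \<in> C 0" if x: "x \<in> interior A" and d: "frechet_derivative (\<lambda>x. l (q x)) (at x) = (\<lambda>h. 0)" for x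
    proof (rule ccontr)
      assume "x \<notin> C 0"
      then have qx: "r < q x" "q x < 1" using x unfolding C_def P_def int by auto
      have "((\<lambda>t. (1 + t) * q x) has_real_derivative q x) (at 0)" by (auto intro!: derivative_eq_intros)
      moreover have "(l has_real_derivative l' (q x)) (at ((1 + 0) * q x))" using l(2)[of "q x"] by simp
      ultimately have "((\<lambda>t. l ((1 + t) * q x)) has_real_derivative l' (q x) * q x) (at 0)"
        by (rule DERIV_chain2[rotated])
      moreover have "\<forall>\<^sub>F t in nhds 0. l ((1 + t) * q x) = l (q (x + t *\<^sub>R x))"
      proof -
        have "\<forall>\<^sub>F t::real in nhds 0. t \<in> {-1<..}" by (rule eventually_nhds_in_open) auto
        then show ?thesis
        proof eventually_elim
          case (elim t)
          then show ?case using q_scale[of "1 + t" x] by (simp add: scaleR_add_left)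
        qed
      qed
      ultimately have "((\<lambda>t. l (q (x + t *\<^sub>R x))) has_real_derivative l' (q x) * q x) (at 0)"
        by (subst (asm) DERIV_cong_ev[OF refl _ refl])
      with equi_Ck_differentiable[OF F0[OF K1(1)] K1(2)]
      have "frechet_derivative (\<lambda>x. l (q x)) (at x) x = l' (q x) * q x"
        by (rule directional_derivative)
      then show False using d l(5)[OF qx] qx r(1) by simp
    qed
    \<comment> \<open>Injectivity of the n-th map: x and P (Suc n) + z = x + h w n both have the
      image P n + z. As \<phi> n is 1 at the second point, h is the increment of \<phi> n along h w
      n, which strict contraction allows only for h = 0.\<close>
    show "x \<in> C (Suc n)" if "x - \<phi> n x *\<^sub>R w n \<in> C n" for n x
    proof -
      define z where "z = x - \<phi> n x *\<^sub>R w n - P n"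
      have z: "q z \<le> r" using that unfolding C_def z_def by simp
      define h where "h = 1 - \<phi> n x"
      have y: "P (Suc n) + z = x + h *\<^sub>R w n" unfolding z_def h_def PS by (simp add: algebra_simps)
      let ?s = "g n (x - P n)" and ?B = "b (q (\<pi> n (x - P n)))"
      have "h = \<phi> n (x + h *\<^sub>R w n) - \<phi> n x" using one[OF z, of n] unfolding y h_def by simp
      also have "\<dots> = (a (?s + h) - a ?s) * ?B"
        unfolding \<phi>_line unfolding \<phi>_def by (simp add: left_diff_distrib)
      finally have heq: "\<bar>h\<bar> = \<bar>a (?s + h) - a ?s\<bar> * \<bar>?B\<bar>" by (metis abs_mult)
      have "h = 0"
      proof (rule ccontr)
        assume "h \<noteq> 0"
        then have "\<bar>a (?s + h) - a ?s\<bar> < \<bar>h\<bar>" using a_contr[of "?s + h" ?s] by simp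
        moreover have "\<bar>a (?s + h) - a ?s\<bar> * \<bar>?B\<bar> \<le> \<bar>a (?s + h) - a ?s\<bar> * 1"
          using b(4,5) by (intro mult_left_mono) auto
        ultimately show False by (metis heq mult.right_neutral not_le)
      qed
      then have "x = P (Suc n) + z" using y by simp
      then show ?thesis using z unfolding C_def by simp
    qed
    show "\<phi> n x \<noteq> 0" if "x \<in> C (Suc n)" for n x
      using one[of "x - P (Suc n)" n] that unfolding C_def by simp
  qed
  then obtain F where F: "\<And>k. k \<in> K \<Longrightarrow> equi_Ck k {F} UNIV"
    "\<And>x. x \<notin> interior A \<Longrightarrow> F x = l (q x)"
    "\<And>x. x \<in> interior A \<Longrightarrow> frechet_derivative F (at x) \<noteq> (\<lambda>h. 0)"
    by blast
  have "{x. F x \<noteq> 0} \<subseteq> interior A" using F(2) l(4) int by force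
  then have sub: "supp F \<subseteq> A"
    unfolding supp_def using star interior_subset[of A]
    by (intro closure_minimal) (auto simp: starlike_body_def)
  \<comment> \<open>Off the support F vanishes on a neighbourhood, so its derivative would be 0
    there; nonvanishing derivatives take the place of nonvanishing values.\<close>
  have "interior A \<subseteq> supp F"
  proof
    fix x assume x: "x \<in> interior A"
    show "x \<in> supp F"
    proof (rule ccontr)
      assume nx: "x \<notin> supp F"
      have "((\<lambda>_. 0) has_derivative (\<lambda>h. 0)) (at x)" by simp
      then have "(F has_derivative (\<lambda>h. 0)) (at x)"
      proof (rule has_derivative_transform_within_open)
        show "open (- supp F)" unfolding supp_def by (rule open_Compl[OF closed_closure])
        show "0 = F y" if "y \<in> - supp F" for y
          using that closure_subset[of "{x. F x \<noteq> 0}"] unfolding supp_def by auto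
      qed (use nx in simp)
      then show False using F(3)[OF x] frechet_derivative_at by metis
    qed
  qed
  then have "closure (interior A) \<subseteq> supp F"
    unfolding supp_def by (intro closure_minimal) auto
  then have supp: "supp F = A" using sub subset_closure_interior[OF star bdd] by blast
  have "0 \<in> interior A" using star unfolding starlike_body_def by simp
  then have "supp F \<noteq> {}" using supp interior_subset by blast
  then have "bump F" unfolding bump_def supp using bdd supp unfolding supp_def by auto
  moreover have "Cp_on p F UNIV"
    unfolding Cp_on_def using F(1) equi_Ck_imp_Ck_on unfolding K_def by blast
  ultimately show ?thesis using supp F(3) by blast
qed

end
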